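(* Consider the forward process $q(\mathbf{x}_{0:N})$ and the Gaussian Markov reverse model $p(\mathbf{x}_{0:N})$ described in the context, and the problem $$\min_{\{\boldsymbol{\mu}_n,\sigma_n^2\}_{n=1}^N} D_{\mathrm{KL}}\big(q(\mathbf{x}_{0:N})\,\|\,p(\mathbf{x}_{0:N})\big).$$ An optimal solution is given, for every $n\in\{1,\dots,N\}$, by $$\boldsymbol{\mu}_n^*(\mathbf{x}_n)=\tilde{\boldsymbol{\mu}}_n\Big(\mathbf{x}_n,\tfrac{1}{\sqrt{\overline{\alpha}_n}}\big(\mathbf{x}_n+\overline{\beta}_n\nabla_{\mathbf{x}_n}\log q_n(\mathbf{x}_n)\big)\Big),$$ $$\sigma_n^{*2}=\lambda_n^2+\Big(\sqrt{\tfrac{\overline{\beta}_n}{\alpha_n}}-\sqrt{\overline{\beta}_{n-1}-\lambda_n^2}\Big)^2\Big(1-\overline{\beta}_n\,\mathbb{E}_{q_n(\mathbf{x}_n)}\frac{\|\nabla_{\mathbf{x}_n}\log q_n(\mathbf{x}_n)\|^2}{d}\Big),$$ where $q_n$ is the marginal density of $\mathbf{x}_n$ under the forward process.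
   Context: Let $d,N\ge 1$. Let $\beta_1,\dots,\beta_N\in(0,1)$, $\alpha_n:=1-\beta_n$, $\overline{\alpha}_n:=\prod_{i=1}^n\alpha_i$, $\overline{\beta}_n:=1-\overline{\alpha}_n$, with the conventions $\overline{\alpha}_0:=1$, $\overline{\beta}_0:=0$. Let $\lambda=(\lambda_1,\dots,\lambda_N)$ be nonnegative with $\lambda_n^2\le\overline{\beta}_{n-1}$ (so $\lambda_1=0$). Let $q(\mathbf{x}_0)$ be a probability density on $\mathbb{R}^d$ with finite second moments. Define $\tilde{\boldsymbol{\mu}}_n(\mathbf{x}_n,\mathbf{x}_0):=\sqrt{\overline{\alpha}_{n-1}}\,\mathbf{x}_0+\sqrt{\overline{\beta}_{n-1}-\lambda_n^2}\cdot\frac{\mathbf{x}_n-\sqrt{\overline{\alpha}_n}\mathbf{x}_0}{\sqrt{\overline{\beta}_n}}$. The forward process is $q(\mathbf{x}_{0:N})=q(\mathbf{x}_0)\,q(\mathbf{x}_N|\mathbf{x}_0)\prod_{n=2}^N q(\mathbf{x}_{n-1}|\mathbf{x}_n,\mathbf{x}_0)$ with $q(\mathbf{x}_N|\mathbf{x}_0)=\mathcal{N}(\mathbf{x}_N|\sqrt{\overline{\alpha}_N}\mathbf{x}_0,\overline{\beta}_N\mathbf{I})$ and $q(\mathbf{x}_{n-1}|\mathbf{x}_n,\mathbf{x}_0)=\mathcal{N}(\mathbf{x}_{n-1}|\tilde{\boldsymbol{\mu}}_n(\mathbf{x}_n,\mathbf{x}_0),\lambda_n^2\mathbf{I})$;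 under it $q(\mathbf{x}_n|\mathbf{x}_0)=\mathcal{N}(\sqrt{\overline{\alpha}_n}\mathbf{x}_0,\overline{\beta}_n\mathbf{I})$ for all $n$. The reverse model is $p(\mathbf{x}_{0:N})=p(\mathbf{x}_N)\prod_{n=1}^N p(\mathbf{x}_{n-1}|\mathbf{x}_n)$ with $p(\mathbf{x}_N)=\mathcal{N}(\mathbf{0},\mathbf{I})$ and $p(\mathbf{x}_{n-1}|\mathbf{x}_n)=\mathcal{N}(\mathbf{x}_{n-1}|\boldsymbol{\mu}_n(\mathbf{x}_n),\sigma_n^2\mathbf{I})$, where $\boldsymbol{\mu}_n:\mathbb{R}^d\to\mathbb{R}^d$ and $\sigma_n^2>0$ are free. *)

theory Defs
  imports "HOL-Probability.Probability"
begin

definition alpha_s :: "(nat \<Rightarrow> real) \<Rightarrow> nat \<Rightarrow> real" where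
  "alpha_s beta n = 1 - beta n"

definition abar :: "(nat \<Rightarrow> real) \<Rightarrow> nat \<Rightarrow> real" where
  "abar beta n = (\<Prod>i=1..n. alpha_s beta i)"

definition bbar :: "(nat \<Rightarrow> real) \<Rightarrow> nat \<Rightarrow> real" where
  "bbar beta n = 1 - abar beta n"

definition mu_tilde :: "(nat \<Rightarrow> real) \<Rightarrow> (nat \<Rightarrow> real) \<Rightarrow> nat \<Rightarrow> 'a::euclidean_space \<Rightarrow> 'a \<Rightarrow> 'a" where
  "mu_tilde beta lam n xn x0 =
     sqrt (abar beta (n - 1)) *\<^sub>R x0
     + (sqrt (bbar beta (n - 1) - (lam n)\<^sup>2) / sqrt (bbar beta n)) *\<^sub>R (xn - sqrt (abar beta n) *\<^sub>R x0)"

definition gauss_dens :: "'a::euclidean_space \<Rightarrow> real \<Rightarrow> 'a \<Rightarrow> real" where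
  "gauss_dens m s x = (2 * pi * s) powr (- real DIM('a) / 2) * exp (- (norm (x - m))\<^sup>2 / (2 * s))"

definition gauss :: "'a::euclidean_space \<Rightarrow> real \<Rightarrow> 'a measure" where
  "gauss m s = (if s = 0 then return lborel m else density lborel (\<lambda>x. ennreal (gauss_dens m s x)))"

definition path_space :: "nat \<Rightarrow> (nat \<Rightarrow> 'a::euclidean_space) measure" where
  "path_space N = Pi\<^sub>M {0..N} (\<lambda>_. lborel)"

text \<open>Forward chain: given a xs with x_k and x_0 set, sample x_{k-1}, ..., x_1 from
  q(x_{n-1} | x_n, x_0) = N(mu_tilde_n(x_n, x_0), lambda_n^2 I).\<close>
primrec q_chain :: "nat \<Rightarrow> (nat \<Rightarrow> real) \<Rightarrow> (nat \<Rightarrow> real) \<Rightarrow> nat \<Rightarrow> (nat \<Rightarrow> 'a::euclidean_space)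
    \<Rightarrow> (nat \<Rightarrow> 'a) measure" where
  "q_chain N beta lam 0 xs = return (path_space N) xs"
| "q_chain N beta lam (Suc j) xs =
     (if j = 0 then return (path_space N) xs
      else gauss (mu_tilde beta lam (Suc j) (xs (Suc j)) (xs 0)) ((lam (Suc j))\<^sup>2)
             \<bind> (\<lambda>y. q_chain N beta lam j (xs(j := y))))"

definition fwd_process :: "nat \<Rightarrow> (nat \<Rightarrow> real) \<Rightarrow> (nat \<Rightarrow> real) \<Rightarrow> ('a::euclidean_space \<Rightarrow> real)
    \<Rightarrow> (nat \<Rightarrow> 'a) measure" where
  "fwd_process N beta lam q0 =
     density lborel (\<lambda>x. ennreal (q0 x)) \<bind> (\<lambda>x0.
     gauss (sqrt (abar beta N) *\<^sub>R x0) (bbar beta N) \<bind> (\<lambda>xN.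
     q_chain N beta lam N (restrict (\<lambda>i. if i = 0 then x0 else xN) {0..N})))"

text \<open>Reverse chain: given a xs with x_k set, sample x_{k-1}, ..., x_0 from
  p(x_{n-1} | x_n) = N(mu_n(x_n), sigma_n^2 I).\<close>
primrec p_chain :: "nat \<Rightarrow> (nat \<Rightarrow> 'a::euclidean_space \<Rightarrow> 'a) \<Rightarrow> (nat \<Rightarrow> real) \<Rightarrow> nat
    \<Rightarrow> (nat \<Rightarrow> 'a) \<Rightarrow> (nat \<Rightarrow> 'a) measure" where
  "p_chain N mu sig2 0 xs = return (path_space N) xs"
| "p_chain N mu sig2 (Suc j) xs =
     gauss (mu (Suc j) (xs (Suc j))) (sig2 (Suc j)) \<bind> (\<lambda>y. p_chain N mu sig2 j (xs(j := y)))"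

definition rev_model :: "nat \<Rightarrow> (nat \<Rightarrow> 'a::euclidean_space \<Rightarrow> 'a) \<Rightarrow> (nat \<Rightarrow> real)
    \<Rightarrow> (nat \<Rightarrow> 'a) measure" where
  "rev_model N mu sig2 =
     gauss 0 1 \<bind> (\<lambda>xN. p_chain N mu sig2 N (restrict (\<lambda>_. xN) {0..N}))"

text \<open>KL(Q || P) = integral of f(dQ/dP) dP with f(t) = t ln t - t + 1 >= 0 if Q << P, and
  infinity otherwise.  For probability measures this is the usual KL divergence
  integral of log(dQ/dP) dQ, including the value +infinity.\<close>
definition kl_f :: "real \<Rightarrow> real" where
  "kl_f t = t * ln t - t + 1"

definition KL :: "'b measure \<Rightarrow> 'b measure \<Rightarrow> ennreal" where
  "KL Q P = (if absolutely_continuous P Q \<and> sets Q = sets P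
             then \<integral>\<^sup>+ x. ennreal (kl_f (enn2real (RN_deriv P Q x))) \<partial>P
             else \<infinity>)"

definition q_marg :: "(nat \<Rightarrow> real) \<Rightarrow> ('a::euclidean_space \<Rightarrow> real) \<Rightarrow> nat \<Rightarrow> 'a \<Rightarrow> real" where
  "q_marg beta q0 n x = (\<integral> x0. q0 x0 * gauss_dens (sqrt (abar beta n) *\<^sub>R x0) (bbar beta n) x \<partial>lborel)"

definition score :: "(nat \<Rightarrow> real) \<Rightarrow> ('a::euclidean_space \<Rightarrow> real) \<Rightarrow> nat \<Rightarrow> 'a \<Rightarrow> 'a" where
  "score beta q0 n x = (SOME g. GDERIV (\<lambda>y. ln (q_marg beta q0 n y)) x :> g)"

definition mu_star :: "(nat \<Rightarrow> real) \<Rightarrow> (nat \<Rightarrow> real) \<Rightarrow> ('a::euclidean_space \<Rightarrow> real) \<Rightarrow> nat \<Rightarrow> 'a \<Rightarrow> 'a" where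
  "mu_star beta lam q0 n x =
     mu_tilde beta lam n x ((1 / sqrt (abar beta n)) *\<^sub>R (x + bbar beta n *\<^sub>R score beta q0 n x))"

definition sigma2_star :: "(nat \<Rightarrow> real) \<Rightarrow> (nat \<Rightarrow> real) \<Rightarrow> ('a::euclidean_space \<Rightarrow> real) \<Rightarrow> nat \<Rightarrow> real" where
  "sigma2_star beta lam q0 n =
     (lam n)\<^sup>2 + (sqrt (bbar beta n / alpha_s beta n) - sqrt (bbar beta (n - 1) - (lam n)\<^sup>2))\<^sup>2
       * (1 - bbar beta n * (\<integral> x. q_marg beta q0 n x * (norm (score beta q0 n x))\<^sup>2 / real DIM('a) \<partial>lborel))"

end

theory Submission
  imports Defs
begin

text \<open>The forward divergence to a reverse model depends on the model only through the log-likelihood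
  ratio, and the likelihood ratio of two Gaussian Markov reverse models is explicit. Its expectation
  under the forward process therefore splits into one term per step, which involves only the mean
  square error of \<^term>\<open>mu n\<close> as a predictor of the previous state from the current one. The best
  predictor is the conditional mean; since the mean of the previous state given both the current and
  the initial state is affine in the initial state, the conditional mean is determined by the
  posterior mean of the initial state, which Tweedie's formula expresses through the score. The
  minimal error per coordinate is then the optimal variance, by the same Pythagorean decomposition.\<close>

subsection \<open>Isotropic Gaussian measures\<close>

text \<open>The forward law may be singular with respect to Lebesgue measure, since
  \<open>lam n = 0\<close> makes the step from \<open>n\<close> to \<open>n - 1\<close>
  deterministic given the initial state; so no density of the forward path is used. The optimum is
  compared with a competitor through their mutual density, which is strictly positive, and a
  competitor of infinite divergence settles the claim at once. The second obstacle is integrability: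
  a competing \<open>mu n\<close> is merely measurable and its square error may have infinite mean.
  Errors are therefore nonnegative integrals, for which the bias-variance split holds with infinite
  values as well, and the log-ratio is bounded below by the part containing only errors of the
  optimum, which have finite mean. Third, \<open>sigma2_star\<close> must be strictly positive even
  for \<open>lam n = 0\<close>: \<open>q0\<close> is a density, so the posterior of the initial
  state has no atom, and \<open>mu_tilde\<close> really depends on that state. The factor
  \<open>1 - bbar * E |score|^2 / d\<close> arises from splitting the total noise energy
  \<open>d * bbar\<close> into the posterior variance and the energy of the score.\<close>

lemma power2_norm_eq_sum_Basis: "(norm y)\<^sup>2 = (\<Sum>b\<in>Basis. (y \<bullet> b)\<^sup>2)"
  unfolding power2_norm_eq_inner by (subst euclidean_inner) (simp add: power2_eq_square)

lemma gauss_dens_nonneg [simp]: "0 \<le> gauss_dens m s x"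
  by (simp add: gauss_dens_def)

lemma gauss_dens_pos: "0 < s \<Longrightarrow> 0 < gauss_dens m s x"
  by (simp add: gauss_dens_def)

lemma borel_measurable_gauss_dens [measurable (raw)]:
  fixes f g :: "'b \<Rightarrow> 'a::euclidean_space"
  assumes [measurable]: "f \<in> borel_measurable M" "g \<in> borel_measurable M"
  shows "(\<lambda>x. gauss_dens (f x) s (g x)) \<in> borel_measurable M"
  unfolding gauss_dens_def by measurable

text \<open>Gaussian integrals over the whole space reduce to one-dimensional ones through this
  factorisation. The second parameter of \<open>gauss_dens\<close> is a variance, that of
  \<open>normal_density\<close> a standard deviation, whence \<open>sqrt s\<close>.\<close>

lemma gauss_dens_eq_prod:
  fixes m x :: "'a::euclidean_space"
  assumes "0 < s"
  shows "gauss_dens m s x = (\<Prod>b\<in>Basis. normal_density (m \<bullet> b) (sqrt s) (x \<bullet> b))"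
proof -
  have "(\<Prod>b\<in>(Basis::'a set). normal_density (m \<bullet> b) (sqrt s) (x \<bullet> b))
      = (1 / sqrt (2 * pi * s)) ^ DIM('a) * (\<Prod>b\<in>(Basis::'a set). exp (- (x \<bullet> b - m \<bullet> b)\<^sup>2 / (2 * s)))"
    using assms unfolding normal_density_def prod.distrib by simp
  also have "(\<Prod>b\<in>(Basis::'a set). exp (- (x \<bullet> b - m \<bullet> b)\<^sup>2 / (2 * s))) = exp (- (norm (x - m))\<^sup>2 / (2 * s))"
    by (subst exp_sum[symmetric])
       (simp_all add: power2_norm_eq_sum_Basis inner_diff_left sum_divide_distrib sum_negf)
  also have "(1 / sqrt (2 * pi * s)) ^ DIM('a) = (2 * pi * s) powr (- real DIM('a) / 2)"
  proof -
    have "1 / sqrt (2 * pi * s) = (2 * pi * s) powr (- (1 / 2))"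
      using assms by (simp only: powr_minus_divide) (subst powr_half_sqrt, auto)
    moreover have "(1 / sqrt (2 * pi * s)) ^ DIM('a) = (1 / sqrt (2 * pi * s)) powr (real DIM('a))"
      using assms by (intro powr_realpow[symmetric]) simp
    ultimately show ?thesis by (simp only: powr_powr) simp
  qed
  finally show ?thesis by (simp add: gauss_dens_def)
qed

lemma nn_integral_normal_density: "0 < \<sigma> \<Longrightarrow> (\<integral>\<^sup>+x. ennreal (normal_density \<mu> \<sigma> x) \<partial>lborel) = 1"
  by (subst nn_integral_eq_integral) auto

lemma nn_integral_normal_density_sq:
  assumes "0 < \<sigma>"
  shows "(\<integral>\<^sup>+x. ennreal (normal_density \<mu> \<sigma> x * (x - v)\<^sup>2) \<partial>lborel) = ennreal (\<sigma>\<^sup>2 + (\<mu> - v)\<^sup>2)"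
proof -
  \<comment> \<open>The square is expanded about the mean; the exponents \<open>2*1\<close>,
    \<open>2*0+1\<close>, \<open>2*0\<close> are spelled so as to match the even and odd moment
    formulas.\<close>
  have "has_bochner_integral lborel (\<lambda>x. normal_density \<mu> \<sigma> x * (x - \<mu>)^(2*1)
      + normal_density \<mu> \<sigma> x * (x - \<mu>)^(2*0+1) * (2 * (\<mu> - v))
      + normal_density \<mu> \<sigma> x * (x - \<mu>)^(2*0) * (\<mu> - v)\<^sup>2)
     (fact (2 * 1) / ((2 / \<sigma>\<^sup>2)^1 * fact 1) + 0 * (2 * (\<mu> - v)) + fact (2 * 0) / ((2 / \<sigma>\<^sup>2)^0 * fact 0) * (\<mu> - v)\<^sup>2)"
    using assms by (intro has_bochner_integral_add has_bochner_integral_mult_left normal_moment_even normal_moment_odd)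
  also have "(\<lambda>x. normal_density \<mu> \<sigma> x * (x - \<mu>)^(2*1)
      + normal_density \<mu> \<sigma> x * (x - \<mu>)^(2*0+1) * (2 * (\<mu> - v))
      + normal_density \<mu> \<sigma> x * (x - \<mu>)^(2*0) * (\<mu> - v)\<^sup>2) = (\<lambda>x. normal_density \<mu> \<sigma> x * (x - v)\<^sup>2)"
    by (auto simp: power2_eq_square algebra_simps)
  finally have "has_bochner_integral lborel (\<lambda>x. normal_density \<mu> \<sigma> x * (x - v)\<^sup>2) (\<sigma>\<^sup>2 + (\<mu> - v)\<^sup>2)"
    using assms by (simp add: fact_2)
  then show ?thesis
    using nn_integral_eq_integral[of lborel "\<lambda>x. normal_density \<mu> \<sigma> x * (x - v)\<^sup>2"]
    by (auto simp: has_bochner_integral_iff)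
qed

lemma nn_integral_gauss_dens:
  fixes m :: "'a::euclidean_space"
  assumes "0 < s"
  shows "(\<integral>\<^sup>+x. ennreal (gauss_dens m s x) \<partial>lborel) = 1"
proof -
  have "(\<integral>\<^sup>+x. (\<Prod>b\<in>(Basis::'a set). ennreal (normal_density (m \<bullet> b) (sqrt s) (x \<bullet> b))) \<partial>lborel)
    = (\<Prod>b\<in>(Basis::'a set). (\<integral>\<^sup>+x. ennreal (normal_density (m \<bullet> b) (sqrt s) x) \<partial>lborel))"
    by (rule nn_integral_lborel_prod) auto
  then show ?thesis
    using assms by (simp add: gauss_dens_eq_prod prod_ennreal nn_integral_normal_density)
qed

lemma nn_integral_gauss_dens_sq:
  fixes m v :: "'a::euclidean_space"
  assumes s: "0 < s"
  shows "(\<integral>\<^sup>+x. ennreal (gauss_dens m s x) * ennreal ((norm (x - v))\<^sup>2) \<partial>lborel)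
    = ennreal (real DIM('a) * s + (norm (m - v))\<^sup>2)"
proof -
  have coord: "(\<integral>\<^sup>+x. ennreal (gauss_dens m s x) * ennreal (((x - v) \<bullet> c)\<^sup>2) \<partial>lborel)
      = ennreal (s + ((m - v) \<bullet> c)\<^sup>2)" if c: "c \<in> Basis" for c :: 'a
  proof -
    \<comment> \<open>The square is attached to the single coordinate \<open>c\<close>, so every
      other factor of the product integral is 1.\<close>
    define f where "f b x = ennreal (normal_density (m \<bullet> b) (sqrt s) x *
      (if b = c then (x - v \<bullet> c)\<^sup>2 else 1))" for b :: 'a and x :: real
    have [measurable]: "f b \<in> borel_measurable borel" for b
      unfolding f_def by (cases "b = c") auto
    have "(\<integral>\<^sup>+x. (\<Prod>b\<in>(Basis::'a set). f b (x \<bullet> b)) \<partial>lborel)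
      = (\<Prod>b\<in>(Basis::'a set). (\<integral>\<^sup>+x. f b x \<partial>lborel))"
      by (rule nn_integral_lborel_prod) auto
    also have "(\<lambda>x::'a. \<Prod>b\<in>(Basis::'a set). f b (x \<bullet> b))
        = (\<lambda>x. ennreal (gauss_dens m s x) * ennreal (((x - v) \<bullet> c)\<^sup>2))"
      unfolding f_def using s c
      by (auto simp: prod_ennreal gauss_dens_eq_prod prod.distrib prod.delta inner_diff_left
          ennreal_mult[symmetric] prod_nonneg)
    also have "(\<Prod>b\<in>Basis. \<integral>\<^sup>+x. f b x \<partial>lborel) = (\<Prod>b\<in>Basis. if b = c then ennreal (s + ((m - v) \<bullet> c)\<^sup>2) else 1)"
      using s nn_integral_normal_density_sq[of "sqrt s" "m \<bullet> c" "v \<bullet> c"]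
      by (intro prod.cong) (auto simp: f_def nn_integral_normal_density inner_diff_left)
    finally show ?thesis using c by (simp add: prod.delta)
  qed
  have "(\<integral>\<^sup>+x. ennreal (gauss_dens m s x) * ennreal ((norm (x - v))\<^sup>2) \<partial>lborel)
     = (\<integral>\<^sup>+x. (\<Sum>c\<in>Basis. ennreal (gauss_dens m s x) * ennreal (((x - v) \<bullet> c)\<^sup>2)) \<partial>lborel)"
    by (simp add: power2_norm_eq_sum_Basis sum_distrib_left[symmetric])
  also have "\<dots> = (\<Sum>c\<in>(Basis::'a set). ennreal (s + ((m - v) \<bullet> c)\<^sup>2))"
    by (subst nn_integral_sum) (auto simp: coord)
  also have "\<dots> = ennreal (real DIM('a) * s + (norm (m - v))\<^sup>2)"
    using s by (subst sum_ennreal) (simp_all add: power2_norm_eq_sum_Basis sum.distrib)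
  finally show ?thesis .
qed

lemma sets_gauss [simp, measurable_cong]: "sets (gauss m s) = sets borel"
  by (simp add: gauss_def)

lemma space_gauss [simp]: "space (gauss m s) = UNIV"
  by (simp add: gauss_def)

lemma nn_integral_gauss:
  assumes [measurable]: "f \<in> borel_measurable borel"
  shows "(\<integral>\<^sup>+x. f x \<partial>gauss m s)
    = (if s = 0 then f m else (\<integral>\<^sup>+x. ennreal (gauss_dens m s x) * f x \<partial>lborel))"
  by (simp add: gauss_def nn_integral_return nn_integral_density)

lemma prob_space_gauss: "0 \<le> s \<Longrightarrow> prob_space (gauss m s)"
  by (auto simp: gauss_def prob_space_return emeasure_density nn_integral_gauss_dens intro!: prob_spaceI)

lemma measurable_gauss [measurable (raw)]:
  fixes f :: "'b \<Rightarrow> 'a::euclidean_space"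
  assumes [measurable]: "f \<in> borel_measurable M" and s: "0 \<le> s"
  shows "(\<lambda>x. gauss (f x) s) \<in> M \<rightarrow>\<^sub>M prob_algebra lborel"
proof (rule measurable_prob_algebraI)
  show "(\<lambda>x. gauss (f x) s) \<in> M \<rightarrow>\<^sub>M subprob_algebra lborel"
  proof (rule measurable_subprob_algebra)
    fix A :: "'a set" assume A[measurable]: "A \<in> sets lborel"
    have "emeasure (gauss (f x) s) A = (if s = 0 then indicator A (f x)
        else (\<integral>\<^sup>+y. ennreal (gauss_dens (f x) s y) * indicator A y \<partial>lborel))" for x
      using nn_integral_gauss[of "indicator A" "f x" s] A by simp
    then show "(\<lambda>x. emeasure (gauss (f x) s) A) \<in> borel_measurable M"
      by simp
  qed (use s in \<open>auto intro: prob_space_imp_subprob_space prob_space_gauss\<close>)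
qed (use s in \<open>auto intro: prob_space_gauss\<close>)

lemma nn_integral_gauss_sq:
  fixes m v :: "'a::euclidean_space"
  assumes "0 \<le> s"
  shows "(\<integral>\<^sup>+x. ennreal ((norm (x - v))\<^sup>2) \<partial>gauss m s) = ennreal (real DIM('a) * s + (norm (m - v))\<^sup>2)"
  using assms nn_integral_gauss_dens_sq[of s m v] by (simp add: nn_integral_gauss)

text \<open>Bayes' rule for y distributed as N(p, s) and z given y as N(m + c (y - p), l), the joint
  density being read in both orders: \<open>T\<close> is the variance of z, \<open>c * s / T\<close>
  the regression coefficient of y on z, \<open>s * l / T\<close> the posterior variance.\<close>

lemma gauss_dens_bayes:
  fixes m p y z :: "'a::euclidean_space"
  assumes s: "0 < s" and l: "0 < l" and T: "T = c\<^sup>2 * s + l"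
  shows "gauss_dens p s y * gauss_dens (m + c *\<^sub>R (y - p)) l z
    = gauss_dens m T z * gauss_dens (p + (c * s / T) *\<^sub>R (z - m)) (s * l / T) y"
proof -
  have Tp: "0 < T" using s l unfolding T by (simp add: add_nonneg_pos)
  define u where "u = y - p"
  define v where "v = z - m"
  have "(norm u)\<^sup>2 / (2 * s) + (norm (v - c *\<^sub>R u))\<^sup>2 / (2 * l)
      = (norm v)\<^sup>2 / (2 * T) + (norm (u - (c * s / T) *\<^sub>R v))\<^sup>2 / (2 * (s * l / T))"
  proof -
    define U W V where "U = u \<bullet> u" "W = u \<bullet> v" "V = v \<bullet> v"
    have 1: "(norm (v - c *\<^sub>R u))\<^sup>2 = V - 2 * c * W + c\<^sup>2 * U"
      unfolding power2_norm_eq_inner by (simp add: inner_diff U_W_V_def inner_commute power2_eq_square algebra_simps)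
    have 2: "(norm (u - (c * s / T) *\<^sub>R v))\<^sup>2 = U - 2 * (c * s / T) * W + (c * s / T)\<^sup>2 * V"
      unfolding power2_norm_eq_inner by (simp add: inner_diff U_W_V_def inner_commute power2_eq_square algebra_simps)
    have 3: "(norm u)\<^sup>2 = U" "(norm v)\<^sup>2 = V" by (simp_all add: power2_norm_eq_inner U_W_V_def)
    \<comment> \<open>Completing the square: facts \<open>4\<close>, \<open>5\<close>,
      \<open>6\<close> match the coefficients of \<open>U\<close>, \<open>V\<close>,
      \<open>W\<close> in the two quadratic forms.\<close>
    have 4: "1 / (2 * s) + c\<^sup>2 / (2 * l) = T / (2 * s * l)"
      using s l by (simp add: T field_simps)
    have "(c * s / T)\<^sup>2 * (T / (2 * s * l)) = c\<^sup>2 * s / (2 * l * T)"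
      using s l Tp by (simp add: power2_eq_square field_simps)
    moreover have "1 / (2 * T) + c\<^sup>2 * s / (2 * l * T) = (c\<^sup>2 * s + l) / (2 * l * T)"
      using l Tp by (simp add: field_simps)
    ultimately have 5: "1 / (2 * T) + (c * s / T)\<^sup>2 * (T / (2 * s * l)) = 1 / (2 * l)"
      using l Tp by (simp add: T[symmetric])
    have 6: "c * s / T * (T / (2 * s * l)) = c / (2 * l)"
      using s l Tp by (simp add: field_simps)
    have "U / (2 * s) + (V - 2 * c * W + c\<^sup>2 * U) / (2 * l)
        = (1 / (2 * s) + c\<^sup>2 / (2 * l)) * U - 2 * (c / (2 * l)) * W + 1 / (2 * l) * V"
      by (simp add: add_divide_distrib diff_divide_distrib algebra_simps)
    also have "\<dots> = V / (2 * T) + (U - 2 * (c * s / T) * W + (c * s / T)\<^sup>2 * V) * (T / (2 * s * l))"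
      unfolding 4 5[symmetric] 6[symmetric] by (simp add: algebra_simps)
    also have "T / (2 * s * l) = 1 / (2 * (s * l / T))"
      by simp
    finally show ?thesis unfolding 1 2 3 by simp
  qed
  then have e: "- ((norm u)\<^sup>2 / (2 * s)) + - ((norm (v - c *\<^sub>R u))\<^sup>2 / (2 * l))
      = - ((norm v)\<^sup>2 / (2 * T)) + - ((norm (u - (c * s / T) *\<^sub>R v))\<^sup>2 / (2 * (s * l / T)))"
    by linarith
  \<comment> \<open>The normalising constants agree because
    \<open>s * l = T * (s * l / T)\<close>.\<close>
  have c: "(2 * pi * s) powr q * (2 * pi * l) powr q = (2 * pi * T) powr q * (2 * pi * (s * l / T)) powr q" for q
    using s l Tp by (simp add: powr_mult[symmetric] mult_ac)
  have 7: "y - p = u" "z - m = v" "z - (m + c *\<^sub>R u) = v - c *\<^sub>R u" "y - (p + (c * s / T) *\<^sub>R v) = u - (c * s / T) *\<^sub>R v"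
    by (simp_all add: u_def v_def)
  have e': "exp (- ((norm u)\<^sup>2 / (2 * s))) * exp (- ((norm (v - c *\<^sub>R u))\<^sup>2 / (2 * l)))
     = exp (- ((norm v)\<^sup>2 / (2 * T))) * exp (- ((norm (u - (c * s / T) *\<^sub>R v))\<^sup>2 / (2 * (s * l / T))))"
    unfolding exp_add[symmetric] e ..
  have "c1 * e1 * (c2 * e2) = c3 * e3 * (c4 * e4)" if "c1 * c2 = c3 * c4" "e1 * e2 = e3 * e4"
    for c1 c2 c3 c4 e1 e2 e3 e4 :: real
    using that by algebra
  from this[OF c[of "- real DIM('a) / 2"] e'] show ?thesis
    unfolding gauss_dens_def 7 minus_divide_left .
qed

text \<open>The power of the absolute value of \<open>c\<close> is the Jacobian of y -> m + c (y -
  p). This is the substitution for a noiseless step, whose kernel has no density.\<close>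

lemma gauss_dens_affine:
  fixes m p y :: "'a::euclidean_space"
  assumes s: "0 < s" and c: "c \<noteq> 0"
  shows "\<bar>c\<bar> ^ DIM('a) * gauss_dens m (c\<^sup>2 * s) (m + c *\<^sub>R (y - p)) = gauss_dens p s y"
proof -
  have "\<bar>c\<bar> ^ DIM('a) = (c\<^sup>2) powr (real DIM('a) / 2)"
  proof -
    have "\<bar>c\<bar> = (c\<^sup>2) powr (1 / 2)" by (simp add: powr_half_sqrt)
    moreover have "\<bar>c\<bar> ^ DIM('a) = \<bar>c\<bar> powr (real DIM('a))" using c by (simp add: powr_realpow)
    ultimately show ?thesis by (simp only: powr_powr) simp
  qed
  moreover have "(2 * pi * (c\<^sup>2 * s)) powr (- real DIM('a) / 2)
     = (c\<^sup>2) powr (- real DIM('a) / 2) * (2 * pi * s) powr (- real DIM('a) / 2)"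
    using s c by (simp add: powr_mult[symmetric] mult_ac)
  moreover have "(c\<^sup>2) powr (real DIM('a) / 2) * (c\<^sup>2) powr (- real DIM('a) / 2) = 1"
    using c by (simp add: powr_add[symmetric])
  ultimately show ?thesis
    using c s by (simp add: gauss_dens_def power_mult_distrib mult.assoc[symmetric])
qed

text \<open>Composition of two Gaussian steps. For \<open>l > 0\<close>, Bayes' rule and Fubini
  leave a posterior density of mass 1; for \<open>l = 0\<close> the inner kernel is a point mass and
  the affine substitution takes over.\<close>

lemma nn_integral_gauss_gauss:
  fixes m p :: "'a::euclidean_space" and f :: "'a \<Rightarrow> ennreal"
  assumes [measurable]: "f \<in> borel_measurable borel"
    and s: "0 < s" and l: "0 \<le> l" and T: "T = c\<^sup>2 * s + l" "0 < T"
  shows "(\<integral>\<^sup>+y. (\<integral>\<^sup>+z. f z \<partial>gauss (m + c *\<^sub>R (y - p)) l) \<partial>gauss p s) = (\<integral>\<^sup>+z. f z \<partial>gauss m T)"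
proof (cases "l = 0")
  case True
  \<comment> \<open>With \<open>l = 0\<close> it is \<open>0 < T\<close> that excludes
    \<open>c = 0\<close>.\<close>
  then have c: "c \<noteq> 0" and T': "T = c\<^sup>2 * s" using T by auto
  have "(\<integral>\<^sup>+z. f z \<partial>gauss m T) = (\<integral>\<^sup>+z. ennreal (gauss_dens m T z) * f z \<partial>
      density (distr lborel borel (\<lambda>x. (m - c *\<^sub>R p) + c *\<^sub>R x)) (\<lambda>_. ennreal (\<bar>c\<bar>^DIM('a))))"
    using T(2) by (subst lborel_affine[OF c, symmetric]) (simp add: nn_integral_gauss)
  also have "\<dots> = (\<integral>\<^sup>+y. ennreal (\<bar>c\<bar>^DIM('a)) * (ennreal (gauss_dens m T (m + c *\<^sub>R (y - p))) * f (m + c *\<^sub>R (y - p))) \<partial>lborel)"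
    by (simp add: nn_integral_density nn_integral_distr algebra_simps)
  also have "\<dots> = (\<integral>\<^sup>+y. ennreal (gauss_dens p s y) * f (m + c *\<^sub>R (y - p)) \<partial>lborel)"
    unfolding T' by (simp add: mult.assoc[symmetric] ennreal_mult[symmetric] gauss_dens_affine[OF s c])
  finally show ?thesis using True s by (simp add: nn_integral_gauss)
next
  case False
  with l have l: "0 < l" by simp
  have "(\<integral>\<^sup>+y. (\<integral>\<^sup>+z. f z \<partial>gauss (m + c *\<^sub>R (y - p)) l) \<partial>gauss p s)
     = (\<integral>\<^sup>+y. (\<integral>\<^sup>+z. ennreal (gauss_dens p s y) * (ennreal (gauss_dens (m + c *\<^sub>R (y - p)) l z) * f z) \<partial>lborel) \<partial>lborel)"
    using s l by (simp add: nn_integral_gauss nn_integral_cmult)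
  also have "\<dots> = (\<integral>\<^sup>+z. (\<integral>\<^sup>+y. ennreal (gauss_dens p s y) * (ennreal (gauss_dens (m + c *\<^sub>R (y - p)) l z) * f z) \<partial>lborel) \<partial>lborel)"
    by (rule lborel_pair.Fubini') simp
  also have "\<dots> = (\<integral>\<^sup>+z. (\<integral>\<^sup>+y. (ennreal (gauss_dens m T z) * f z) * ennreal (gauss_dens (p + (c * s / T) *\<^sub>R (z - m)) (s * l / T) y) \<partial>lborel) \<partial>lborel)"
  proof -
    have "ennreal (gauss_dens p s y) * (ennreal (gauss_dens (m + c *\<^sub>R (y - p)) l z) * f z)
        = ennreal (gauss_dens p s y * gauss_dens (m + c *\<^sub>R (y - p)) l z) * f z" for y z
      by (simp add: ennreal_mult mult.assoc)
    also have "\<dots> y z = (ennreal (gauss_dens m T z) * f z) * ennreal (gauss_dens (p + (c * s / T) *\<^sub>R (z - m)) (s * l / T) y)" for y z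
      unfolding gauss_dens_bayes[OF s l T(1)] by (simp add: ennreal_mult mult_ac)
    finally show ?thesis by simp
  qed
  also have "\<dots> = (\<integral>\<^sup>+z. ennreal (gauss_dens m T z) * f z \<partial>lborel)"
    using s l T(2) by (simp add: nn_integral_cmult nn_integral_gauss_dens)
  finally show ?thesis using T(2) by (simp add: nn_integral_gauss)
qed

lemma ln_gauss_dens:
  "0 < s \<Longrightarrow> ln (gauss_dens m s x) = - (real DIM('b) / 2) * ln (2 * pi * s) - (norm (x - m))\<^sup>2 / (2 * s)"
  for m x :: "'b::euclidean_space"
  unfolding gauss_dens_def by (subst ln_mult_pos) (auto simp: ln_powr)

subsection \<open>Kernels on path space\<close>

lemma measurable_path_component [measurable (raw)]:
  assumes "f \<in> M \<rightarrow>\<^sub>M path_space N" "i \<le> N"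
  shows "(\<lambda>x. f x i) \<in> borel_measurable M"
proof -
  have "(\<lambda>xs. xs i) \<in> (path_space N :: (nat \<Rightarrow> 'b) measure) \<rightarrow>\<^sub>M lborel"
    using assms(2) unfolding path_space_def by (intro measurable_component_singleton) auto
  from measurable_compose[OF assms(1) this] show ?thesis by simp
qed

lemma measurable_path_upd [measurable (raw)]:
  assumes "f \<in> M \<rightarrow>\<^sub>M path_space N" "h \<in> borel_measurable M" "j \<le> N"
  shows "(\<lambda>x. (f x)(j := h x)) \<in> M \<rightarrow>\<^sub>M path_space N"
  using assms unfolding path_space_def
  by (intro measurable_fun_upd[where J="{0..N}"]) auto

lemma measurable_path_restrict [measurable (raw)]:
  assumes "\<And>i. i \<le> N \<Longrightarrow> (\<lambda>x. f x i) \<in> borel_measurable M"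
  shows "(\<lambda>x. restrict (f x) {0..N}) \<in> M \<rightarrow>\<^sub>M path_space N"
  using assms unfolding path_space_def by (intro measurable_restrict) auto

lemma space_path_upd: "xs \<in> space (path_space N) \<Longrightarrow> j \<le> N \<Longrightarrow> xs(j := y) \<in> space (path_space N)"
  by (auto simp: path_space_def space_PiM PiE_iff extensional_def)

lemma space_path_restrict: "restrict f {0..N} \<in> space (path_space N)"
  by (auto simp: path_space_def space_PiM)

lemma borel_measurable_mu_tilde [measurable (raw)]:
  fixes f g :: "'b \<Rightarrow> 'a::euclidean_space"
  assumes [measurable]: "f \<in> borel_measurable M" "g \<in> borel_measurable M"
  shows "(\<lambda>x. mu_tilde beta lam n (f x) (g x)) \<in> borel_measurable M"
  unfolding mu_tilde_def by measurable

lemma measurable_q_chain: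
  "k \<le> N \<Longrightarrow> q_chain N beta lam k \<in> (path_space N :: (nat \<Rightarrow> 'a::euclidean_space) measure) \<rightarrow>\<^sub>M prob_algebra (path_space N)"
proof (induction k)
  case 0
  then show ?case by (simp add: measurable_return_prob_space)
next
  case (Suc j)
  then have [measurable]: "q_chain N beta lam j \<in> (path_space N :: (nat \<Rightarrow> 'a) measure) \<rightarrow>\<^sub>M prob_algebra (path_space N)"
    by simp
  have k: "Suc j \<le> N" "j \<le> N" using Suc.prems by auto
  show ?case
  proof (cases "j = 0")
    case False
    have "(\<lambda>xs. gauss (mu_tilde beta lam (Suc j) (xs (Suc j)) (xs 0)) ((lam (Suc j))\<^sup>2)
             \<bind> (\<lambda>y. q_chain N beta lam j (xs(j := y)))) \<in> (path_space N :: (nat \<Rightarrow> 'a) measure) \<rightarrow>\<^sub>M prob_algebra (path_space N)"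
      using k by (intro measurable_bind_prob_space2[where N=lborel] measurable_gauss) measurable
    then show ?thesis using False by simp
  qed (simp add: measurable_return_prob_space)
qed

lemma measurable_p_chain:
  "k \<le> N \<Longrightarrow> \<forall>n\<in>{1..k}. mu n \<in> borel_measurable borel \<and> 0 < sig2 n \<Longrightarrow>
   p_chain N mu sig2 k \<in> (path_space N :: (nat \<Rightarrow> 'a::euclidean_space) measure) \<rightarrow>\<^sub>M prob_algebra (path_space N)"
proof (induction k)
  case 0
  then show ?case by (simp add: measurable_return_prob_space)
next
  case (Suc j)
  then have [measurable]: "p_chain N mu sig2 j \<in> (path_space N :: (nat \<Rightarrow> 'a) measure) \<rightarrow>\<^sub>M prob_algebra (path_space N)"
    "mu (Suc j) \<in> borel_measurable borel"
    by auto
  have k: "Suc j \<le> N" "j \<le> N" "0 \<le> sig2 (Suc j)" using Suc.prems by (auto intro: less_imp_le)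
  have "(\<lambda>xs. gauss (mu (Suc j) (xs (Suc j))) (sig2 (Suc j))
           \<bind> (\<lambda>y. p_chain N mu sig2 j (xs(j := y)))) \<in> (path_space N :: (nat \<Rightarrow> 'a) measure) \<rightarrow>\<^sub>M prob_algebra (path_space N)"
    using k by (intro measurable_bind_prob_space2[where N=lborel] measurable_gauss) measurable
  then show ?case by simp
qed

lemma measurable_gauss_kernel:
  "K \<in> borel \<rightarrow>\<^sub>M prob_algebra R \<Longrightarrow> K \<in> gauss m s \<rightarrow>\<^sub>M subprob_algebra R"
  by (intro measurable_prob_algebraD) (simp cong: measurable_cong_sets)

section \<open>Coordinates read and written by the chains\<close>

lemma nn_integral_q_chain_Suc:
  fixes xs :: "nat \<Rightarrow> 'a::euclidean_space"
  assumes f: "f \<in> borel_measurable (path_space N)" and k: "Suc j \<le> N" "0 < j"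
    and xs: "xs \<in> space (path_space N)"
  shows "(\<integral>\<^sup>+z. f z \<partial>q_chain N beta lam (Suc j) xs)
    = (\<integral>\<^sup>+y. (\<integral>\<^sup>+z. f z \<partial>q_chain N beta lam j (xs(j := y)))
        \<partial>gauss (mu_tilde beta lam (Suc j) (xs (Suc j)) (xs 0)) ((lam (Suc j))\<^sup>2))"
proof -
  have [measurable]: "q_chain N beta lam j \<in> (path_space N :: (nat \<Rightarrow> 'a) measure) \<rightarrow>\<^sub>M prob_algebra (path_space N)"
    using k by (intro measurable_q_chain) simp
  have "(\<lambda>y. q_chain N beta lam j (xs(j := y))) \<in> borel \<rightarrow>\<^sub>M prob_algebra (path_space N)"
    using k Suc_leD[OF k(1)] xs by measurable
  from measurable_gauss_kernel[OF this] show ?thesis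
    using k by (simp add: nn_integral_bind[OF f])
qed

lemma nn_integral_p_chain_Suc:
  fixes xs :: "nat \<Rightarrow> 'a::euclidean_space"
  assumes f: "f \<in> borel_measurable (path_space N)" and k: "Suc j \<le> N"
    and mu: "\<forall>n\<in>{1..Suc j}. mu n \<in> borel_measurable borel \<and> 0 < sig2 n"
    and xs: "xs \<in> space (path_space N)"
  shows "(\<integral>\<^sup>+z. f z \<partial>p_chain N mu sig2 (Suc j) xs)
    = (\<integral>\<^sup>+y. (\<integral>\<^sup>+z. f z \<partial>p_chain N mu sig2 j (xs(j := y))) \<partial>gauss (mu (Suc j) (xs (Suc j))) (sig2 (Suc j)))"
proof -
  have [measurable]: "p_chain N mu sig2 j \<in> (path_space N :: (nat \<Rightarrow> 'a) measure) \<rightarrow>\<^sub>M prob_algebra (path_space N)"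
    using k mu by (intro measurable_p_chain) auto
  have "(\<lambda>y. p_chain N mu sig2 j (xs(j := y))) \<in> borel \<rightarrow>\<^sub>M prob_algebra (path_space N)"
    using k Suc_leD[OF k] xs by measurable
  from measurable_gauss_kernel[OF this] show ?thesis
    by (simp add: nn_integral_bind[OF f])
qed

lemma borel_measurable_nn_integral_q_chain:
  fixes h :: "'b \<Rightarrow> nat \<Rightarrow> 'a::euclidean_space"
  assumes f: "f \<in> borel_measurable (path_space N)" and k: "k \<le> N" and h: "h \<in> M \<rightarrow>\<^sub>M path_space N"
  shows "(\<lambda>x. \<integral>\<^sup>+z. f z \<partial>q_chain N beta lam k (h x)) \<in> borel_measurable M"
  using measurable_compose[OF h measurable_compose[OF measurable_prob_algebraD[OF measurable_q_chain[OF k]]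
    nn_integral_measurable_subprob_algebra[OF f]]] .

lemma borel_measurable_nn_integral_p_chain:
  fixes h :: "'b \<Rightarrow> nat \<Rightarrow> 'a::euclidean_space"
  assumes f: "f \<in> borel_measurable (path_space N)" and k: "k \<le> N" and h: "h \<in> M \<rightarrow>\<^sub>M path_space N"
    and mu: "\<forall>n\<in>{1..k}. mu n \<in> borel_measurable borel \<and> 0 < sig2 n"
  shows "(\<lambda>x. \<integral>\<^sup>+z. f z \<partial>p_chain N mu sig2 k (h x)) \<in> borel_measurable M"
  using measurable_compose[OF h measurable_compose[OF measurable_prob_algebraD[OF measurable_p_chain[OF k mu]]
    nn_integral_measurable_subprob_algebra[OF f]]] .

lemma borel_measurable_nn_integral_gauss [measurable (raw)]:
  fixes m :: "'b \<Rightarrow> 'a::euclidean_space" and f :: "'b \<Rightarrow> 'a \<Rightarrow> ennreal"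
  assumes f: "(\<lambda>(x, y). f x y) \<in> borel_measurable (M \<Otimes>\<^sub>M borel)" and m: "m \<in> borel_measurable M" and s: "0 \<le> s"
  shows "(\<lambda>x. \<integral>\<^sup>+y. f x y \<partial>gauss (m x) s) \<in> borel_measurable M"
  using f s m by (intro nn_integral_measurable_subprob_algebra2[where N=lborel] measurable_prob_algebraD)
    (auto simp: measurable_gauss cong: measurable_cong_sets)

lemma nn_integral_gauss_const: "0 \<le> s \<Longrightarrow> (\<integral>\<^sup>+y. c \<partial>gauss m s) = c"
  using prob_space.emeasure_space_1[OF prob_space_gauss[of s m]] by simp

text \<open>From level \<open>k\<close> the forward chain rewrites only the coordinates 1 to
  \<open>k - 1\<close>. A function blind to them is constant along the chain, and each sampled
  coordinate integrates to mass 1.\<close>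

lemma nn_integral_q_chain_eq:
  fixes f :: "(nat \<Rightarrow> 'a::euclidean_space) \<Rightarrow> ennreal"
  assumes f: "f \<in> borel_measurable (path_space N)"
    and dep: "\<And>xs ys. \<forall>i. i = 0 \<or> k \<le> i \<longrightarrow> xs i = ys i \<Longrightarrow> f xs = f ys"
  shows "k \<le> N \<Longrightarrow> xs \<in> space (path_space N) \<Longrightarrow> (\<integral>\<^sup>+z. f z \<partial>q_chain N beta lam k xs) = f xs"
  using dep
proof (induction k arbitrary: xs)
  case 0
  then show ?case using f by (simp add: nn_integral_return)
next
  case (Suc j)
  show ?case
  proof (cases "j = 0")
    case True
    then show ?thesis using f Suc.prems by (simp add: nn_integral_return)
  next
    case False
    have IH: "(\<integral>\<^sup>+z. f z \<partial>q_chain N beta lam j (xs(j := y))) = f xs" for y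
    proof -
      have "(\<integral>\<^sup>+z. f z \<partial>q_chain N beta lam j (xs(j := y))) = f (xs(j := y))"
        using Suc.prems by (intro Suc.IH space_path_upd) auto
      also have "\<dots> = f xs" using False by (intro Suc.prems(3)) auto
      finally show ?thesis .
    qed
    show ?thesis
      using False Suc.prems by (subst nn_integral_q_chain_Suc[OF f]) (auto simp: IH nn_integral_gauss_const simp del: nn_integral_const)
  qed
qed

text \<open>From level \<open>k\<close> the chain reads only the coordinates 0 and \<open>k\<close>
  of its starting path and overwrites those strictly between, so the placeholders stored there do
  not influence the integral. This permits restarting the chain from a fresh path after each sampled
  coordinate.\<close>

lemma nn_integral_q_chain_cong:
  fixes f :: "(nat \<Rightarrow> 'a::euclidean_space) \<Rightarrow> ennreal"
  assumes f: "f \<in> borel_measurable (path_space N)"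
    and dep: "\<And>xs ys. \<forall>i\<le>M. xs i = ys i \<Longrightarrow> f xs = f ys"
  shows "k \<le> M \<Longrightarrow> M \<le> N \<Longrightarrow> xs \<in> space (path_space N) \<Longrightarrow> ys \<in> space (path_space N) \<Longrightarrow>
    \<forall>i\<le>M. i = 0 \<or> k \<le> i \<longrightarrow> xs i = ys i \<Longrightarrow>
    (\<integral>\<^sup>+z. f z \<partial>q_chain N beta lam k xs) = (\<integral>\<^sup>+z. f z \<partial>q_chain N beta lam k ys)"
proof (induction k arbitrary: xs ys)
  case 0
  then show ?case using f dep[of xs ys] by (simp add: nn_integral_return)
next
  case (Suc j)
  show ?case
  proof (cases "j = 0")
    case True
    then have "\<forall>i\<le>M. xs i = ys i" using Suc.prems(5) by (metis One_nat_def Suc_leI neq0_conv)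
    then have "f xs = f ys" by (rule dep)
    with True show ?thesis using f Suc.prems by (simp add: nn_integral_return)
  next
    case False
    have IH: "(\<integral>\<^sup>+z. f z \<partial>q_chain N beta lam j (xs(j := y))) = (\<integral>\<^sup>+z. f z \<partial>q_chain N beta lam j (ys(j := y)))" for y
      using Suc.prems by (intro Suc.IH space_path_upd) (auto simp: Suc_le_eq)
    have "xs 0 = ys 0" "xs (Suc j) = ys (Suc j)" using Suc.prems by auto
    with False Suc.prems show ?thesis
      by (simp only: nn_integral_q_chain_Suc[OF f] IH)
  qed
qed

text \<open>The reverse chain from level \<open>k\<close> writes only coordinates below
  \<open>k\<close>, so a factor reading the others is constant along it.\<close>

lemma p_chain_pullout:
  fixes f :: "(nat \<Rightarrow> 'a::euclidean_space) \<Rightarrow> ennreal"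
  assumes f: "f \<in> borel_measurable (path_space N)" and g: "g \<in> borel_measurable (path_space N)"
    and dep: "\<And>xs ys. \<forall>i\<ge>k. xs i = ys i \<Longrightarrow> g xs = g ys"
  shows "k \<le> N \<Longrightarrow> \<forall>n\<in>{1..k}. mu n \<in> borel_measurable borel \<and> 0 < sig2 n \<Longrightarrow> xs \<in> space (path_space N) \<Longrightarrow>
    (\<integral>\<^sup>+z. g z * f z \<partial>p_chain N mu sig2 k xs) = g xs * (\<integral>\<^sup>+z. f z \<partial>p_chain N mu sig2 k xs)"
  using dep
proof (induction k arbitrary: xs)
  case 0
  then show ?case using f g by (simp add: nn_integral_return)
next
  case (Suc j)
  have [measurable]: "(\<lambda>y. xs(j := y)) \<in> borel \<rightarrow>\<^sub>M path_space N"
    using Suc.prems Suc_leD[OF Suc.prems(1)] by measurable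
  have IH: "(\<integral>\<^sup>+z. g z * f z \<partial>p_chain N mu sig2 j (xs(j := y))) = g xs * (\<integral>\<^sup>+z. f z \<partial>p_chain N mu sig2 j (xs(j := y)))" for y
  proof -
    have "(\<integral>\<^sup>+z. g z * f z \<partial>p_chain N mu sig2 j (xs(j := y))) = g (xs(j := y)) * (\<integral>\<^sup>+z. f z \<partial>p_chain N mu sig2 j (xs(j := y)))"
      using Suc.prems by (intro Suc.IH space_path_upd) auto
    also have "g (xs(j := y)) = g xs" by (intro Suc.prems(4)) auto
    finally show ?thesis .
  qed
  have [measurable]: "(\<lambda>y. \<integral>\<^sup>+z. f z \<partial>p_chain N mu sig2 j (xs(j := y))) \<in> borel_measurable borel"
    using Suc.prems f by (intro borel_measurable_nn_integral_p_chain) auto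
  have gf: "(\<lambda>z. g z * f z) \<in> borel_measurable (path_space N)" using f g by simp
  show ?case
    using Suc.prems
    by (simp only: nn_integral_p_chain_Suc[OF gf] nn_integral_p_chain_Suc[OF f] IH)
       (subst nn_integral_cmult, auto cong: measurable_cong_sets)
qed

lemma borel_measurable_path_pair:
  fixes F :: "'a::euclidean_space \<Rightarrow> 'a \<Rightarrow> 'b::topological_space"
  assumes F: "(\<lambda>(y, w). F y w) \<in> borel_measurable (borel \<Otimes>\<^sub>M borel)" and n: "n \<le> N"
  shows "(\<lambda>z. F (z (n - 1)) (z n)) \<in> borel_measurable (path_space N)"
proof -
  have "n - 1 \<le> N" using n by simp
  then have "(\<lambda>z. (z (n - 1), z n)) \<in> path_space N \<rightarrow>\<^sub>M (borel \<Otimes>\<^sub>M borel :: ('a \<times> 'a) measure)"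
    using n by (intro measurable_Pair measurable_path_component measurable_ident) auto
  from measurable_compose[OF this F] show ?thesis by simp
qed

subsection \<open>Likelihood ratios of reverse models\<close>

text \<open>The density of the primed reverse model relative to the unprimed one. The terminal law
  N(0, I) is common to both and cancels, so only transition densities appear.\<close>

definition path_ratio :: "(nat \<Rightarrow> 'a::euclidean_space \<Rightarrow> 'a) \<Rightarrow> (nat \<Rightarrow> real) \<Rightarrow> (nat \<Rightarrow> 'a \<Rightarrow> 'a) \<Rightarrow> (nat \<Rightarrow> real)
    \<Rightarrow> nat \<Rightarrow> (nat \<Rightarrow> 'a) \<Rightarrow> real" where
  "path_ratio mu sig2 mu' sig2' k z =
     (\<Prod>n=1..k. gauss_dens (mu' n (z n)) (sig2' n) (z (n - 1)) / gauss_dens (mu n (z n)) (sig2 n) (z (n - 1)))"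

lemma borel_measurable_path_ratio:
  assumes "k \<le> N" "\<forall>n\<in>{1..k}. mu n \<in> borel_measurable borel" "\<forall>n\<in>{1..k}. mu' n \<in> borel_measurable borel"
  shows "path_ratio mu sig2 mu' sig2' k \<in> borel_measurable (path_space N :: (nat \<Rightarrow> 'a::euclidean_space) measure)"
  unfolding path_ratio_def
proof (intro borel_measurable_prod borel_measurable_divide)
  fix n assume n: "n \<in> {1..k}"
  then have k: "n \<le> N" "n - 1 \<le> N" using assms(1) by auto
  have [measurable]: "mu n \<in> borel_measurable borel" "mu' n \<in> borel_measurable borel" using assms n by auto
  show "(\<lambda>z. gauss_dens (mu' n (z n)) (sig2' n) (z (n - 1))) \<in> borel_measurable (path_space N)"
    "(\<lambda>z. gauss_dens (mu n (z n)) (sig2 n) (z (n - 1))) \<in> borel_measurable (path_space N)"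
    using k by measurable
qed

lemma path_ratio_pos:
  "\<forall>n\<in>{1..k}. 0 < sig2 n \<Longrightarrow> \<forall>n\<in>{1..k}. 0 < sig2' n \<Longrightarrow> 0 < path_ratio mu sig2 mu' sig2' k z"
  unfolding path_ratio_def by (intro prod_pos) (auto intro!: divide_pos_pos gauss_dens_pos)

text \<open>Each transition has a positive Gaussian density, so it can be exchanged for the other
  model's at the price of a quotient; induction collects the quotients.\<close>

lemma nn_integral_p_chain_change:
  fixes f :: "(nat \<Rightarrow> 'a::euclidean_space) \<Rightarrow> ennreal"
  assumes f: "f \<in> borel_measurable (path_space N)"
  shows "k \<le> N \<Longrightarrow> \<forall>n\<in>{1..k}. mu n \<in> borel_measurable borel \<and> 0 < sig2 n \<Longrightarrow>
    \<forall>n\<in>{1..k}. mu' n \<in> borel_measurable borel \<and> 0 < sig2' n \<Longrightarrow> xs \<in> space (path_space N) \<Longrightarrow>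
    (\<integral>\<^sup>+z. f z \<partial>p_chain N mu' sig2' k xs)
      = (\<integral>\<^sup>+z. ennreal (path_ratio mu sig2 mu' sig2' k z) * f z \<partial>p_chain N mu sig2 k xs)"
proof (induction k arbitrary: xs)
  case 0
  then show ?case using f by (simp add: nn_integral_return path_ratio_def)
next
  case (Suc j)
  define g where "g z = gauss_dens (mu' (Suc j) (z (Suc j))) (sig2' (Suc j)) (z j) / gauss_dens (mu (Suc j) (z (Suc j))) (sig2 (Suc j)) (z j)"
    for z :: "nat \<Rightarrow> 'a"
  let ?R = "path_ratio mu sig2 mu' sig2'"
  have j: "j \<le> N" "Suc j \<le> N" and pos: "0 < sig2 (Suc j)" "0 < sig2' (Suc j)"
    and mu_j: "\<forall>n\<in>{1..j}. mu n \<in> borel_measurable borel \<and> 0 < sig2 n"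
      "\<forall>n\<in>{1..j}. mu' n \<in> borel_measurable borel \<and> 0 < sig2' n"
    using Suc.prems by auto
  have [measurable]: "mu (Suc j) \<in> borel_measurable borel" "mu' (Suc j) \<in> borel_measurable borel"
    using Suc.prems by auto
  have [measurable]: "?R j \<in> borel_measurable (path_space N)" "?R (Suc j) \<in> borel_measurable (path_space N)"
    using Suc.prems by (auto intro!: borel_measurable_path_ratio)
  have g_meas: "(\<lambda>z. ennreal (g z)) \<in> borel_measurable (path_space N)"
    unfolding g_def using j by measurable
  have R_nonneg: "0 \<le> ?R j z" for z
    by (rule less_imp_le, rule path_ratio_pos) (use Suc.prems in auto)
  have g_nonneg: "0 \<le> g z" for z by (simp add: g_def)
  have R_Suc: "?R (Suc j) z = g z * ?R j z" for z
    by (simp add: path_ratio_def g_def)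
  have [measurable]: "(\<lambda>y. xs(j := y)) \<in> borel \<rightarrow>\<^sub>M path_space N"
    using Suc.prems j by measurable
  define I where "I y = (\<integral>\<^sup>+z. ennreal (?R j z) * f z \<partial>p_chain N mu sig2 j (xs(j := y)))" for y
  have [measurable]: "I \<in> borel_measurable borel"
    unfolding I_def using f j mu_j by (intro borel_measurable_nn_integral_p_chain) auto
  have "(\<integral>\<^sup>+z. f z \<partial>p_chain N mu' sig2' (Suc j) xs)
     = (\<integral>\<^sup>+y. I y \<partial>gauss (mu' (Suc j) (xs (Suc j))) (sig2' (Suc j)))"
    unfolding nn_integral_p_chain_Suc[OF f j(2) Suc.prems(3,4)] I_def using Suc.prems j mu_j
    by (intro nn_integral_cong Suc.IH space_path_upd) auto
  also have "\<dots> = (\<integral>\<^sup>+y. ennreal (gauss_dens (mu' (Suc j) (xs (Suc j))) (sig2' (Suc j)) y) * I y \<partial>lborel)"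
    using pos by (simp add: nn_integral_gauss)
  also have "\<dots> = (\<integral>\<^sup>+y. ennreal (gauss_dens (mu (Suc j) (xs (Suc j))) (sig2 (Suc j)) y) * (ennreal (g (xs(j := y))) * I y) \<partial>lborel)"
  proof (rule nn_integral_cong)
    fix y
    have "gauss_dens (mu (Suc j) (xs (Suc j))) (sig2 (Suc j)) y > 0" using pos by (simp add: gauss_dens_pos)
    then show "ennreal (gauss_dens (mu' (Suc j) (xs (Suc j))) (sig2' (Suc j)) y) * I y
      = ennreal (gauss_dens (mu (Suc j) (xs (Suc j))) (sig2 (Suc j)) y) * (ennreal (g (xs(j := y))) * I y)"
      by (simp add: g_def mult.assoc[symmetric] ennreal_mult[symmetric])
  qed
  also have "\<dots> = (\<integral>\<^sup>+y. ennreal (g (xs(j := y))) * I y \<partial>gauss (mu (Suc j) (xs (Suc j))) (sig2 (Suc j)))"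
    using pos g_meas by (simp add: nn_integral_gauss)
  also have "\<dots> = (\<integral>\<^sup>+y. (\<integral>\<^sup>+z. ennreal (?R (Suc j) z) * f z \<partial>p_chain N mu sig2 j (xs(j := y)))
      \<partial>gauss (mu (Suc j) (xs (Suc j))) (sig2 (Suc j)))"
  proof (rule nn_integral_cong)
    fix y
    \<comment> \<open>\<open>g\<close> reads only the coordinates \<open>j\<close> and
      \<open>Suc j\<close>, which the remaining chain from level \<open>j\<close> leaves alone, so
      it leaves the inner integral.\<close>
    have "(\<integral>\<^sup>+z. ennreal (g z) * (ennreal (?R j z) * f z) \<partial>p_chain N mu sig2 j (xs(j := y))) = ennreal (g (xs(j := y))) * I y"
      unfolding I_def using g_meas f Suc.prems j mu_j
      by (intro p_chain_pullout space_path_upd) (auto simp: g_def)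
    then show "ennreal (g (xs(j := y))) * I y = (\<integral>\<^sup>+z. ennreal (?R (Suc j) z) * f z \<partial>p_chain N mu sig2 j (xs(j := y)))"
      by (simp add: R_Suc ennreal_mult R_nonneg g_nonneg mult.assoc)
  qed
  also have "\<dots> = (\<integral>\<^sup>+z. ennreal (?R (Suc j) z) * f z \<partial>p_chain N mu sig2 (Suc j) xs)"
    using f j Suc.prems by (subst nn_integral_p_chain_Suc) auto
  finally show ?case .
qed

lemma measurable_rev_kernel:
  assumes "\<forall>n\<in>{1..N}. mu n \<in> borel_measurable borel \<and> 0 < sig2 n"
  shows "(\<lambda>x::'a::euclidean_space. p_chain N mu sig2 N (restrict (\<lambda>_. x) {0..N})) \<in> borel \<rightarrow>\<^sub>M prob_algebra (path_space N)"
  using assms by (intro measurable_compose[OF _ measurable_p_chain]) auto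

lemma rev_model_in_prob_algebra:
  assumes "\<forall>n\<in>{1..N}. mu n \<in> borel_measurable borel \<and> 0 < sig2 n"
  shows "rev_model N mu sig2 \<in> space (prob_algebra (path_space N))"
proof -
  have "gauss (0::'a) 1 \<in> space (prob_algebra lborel)"
    by (simp add: space_prob_algebra prob_space_gauss)
  moreover have "(\<lambda>x::'a. p_chain N mu sig2 N (restrict (\<lambda>_. x) {0..N})) \<in> lborel \<rightarrow>\<^sub>M prob_algebra (path_space N)"
    using measurable_rev_kernel[OF assms] by simp
  ultimately show ?thesis
    unfolding rev_model_def by (simp add: space_prob_algebra[of "path_space N"] prob_space_bind' sets_bind')
qed

lemma rev_model_change:
  fixes mu :: "nat \<Rightarrow> 'a::euclidean_space \<Rightarrow> 'a"
  assumes mu: "\<forall>n\<in>{1..N}. mu n \<in> borel_measurable borel \<and> 0 < sig2 n"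
    and mu': "\<forall>n\<in>{1..N}. mu' n \<in> borel_measurable borel \<and> 0 < sig2' n"
  shows "rev_model N mu' sig2' = density (rev_model N mu sig2) (\<lambda>z. ennreal (path_ratio mu sig2 mu' sig2' N z))"
proof (rule measure_eqI)
  have sets: "sets (rev_model N mu sig2) = sets (path_space N)" "sets (rev_model N mu' sig2') = sets (path_space N)"
    using rev_model_in_prob_algebra[OF mu] rev_model_in_prob_algebra[OF mu'] by (simp_all add: space_prob_algebra)
  then show "sets (rev_model N mu' sig2') = sets (density (rev_model N mu sig2) (\<lambda>z. ennreal (path_ratio mu sig2 mu' sig2' N z)))"
    by simp
  fix A assume "A \<in> sets (rev_model N mu' sig2')"
  then have A[measurable]: "A \<in> sets (path_space N)" using sets by simp
  have [measurable]: "path_ratio mu sig2 mu' sig2' N \<in> borel_measurable (path_space N)"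
    using mu mu' by (auto intro!: borel_measurable_path_ratio)
  have "emeasure (rev_model N mu' sig2') A = (\<integral>\<^sup>+z. indicator A z \<partial>rev_model N mu' sig2')"
    using A sets by simp
  also have "\<dots> = (\<integral>\<^sup>+x. (\<integral>\<^sup>+z. indicator A z \<partial>p_chain N mu' sig2' N (restrict (\<lambda>_. x) {0..N})) \<partial>gauss 0 1)"
    unfolding rev_model_def
    by (rule nn_integral_bind[OF _ measurable_gauss_kernel[OF measurable_rev_kernel[OF mu']]]) simp
  also have "\<dots> = (\<integral>\<^sup>+x. (\<integral>\<^sup>+z. ennreal (path_ratio mu sig2 mu' sig2' N z) * indicator A z \<partial>p_chain N mu sig2 N (restrict (\<lambda>_. x) {0..N})) \<partial>gauss 0 1)"
    using mu mu' by (intro nn_integral_cong nn_integral_p_chain_change space_path_restrict) auto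
  also have "\<dots> = (\<integral>\<^sup>+z. ennreal (path_ratio mu sig2 mu' sig2' N z) * indicator A z \<partial>rev_model N mu sig2)"
    unfolding rev_model_def
    by (rule nn_integral_bind[OF _ measurable_gauss_kernel[OF measurable_rev_kernel[OF mu]], symmetric]) simp
  also have "\<dots> = emeasure (density (rev_model N mu sig2) (\<lambda>z. ennreal (path_ratio mu sig2 mu' sig2' N z))) A"
    using sets by (subst emeasure_density) (auto cong: measurable_cong_sets)
  finally show "emeasure (rev_model N mu' sig2') A = emeasure (density (rev_model N mu sig2) (\<lambda>z. ennreal (path_ratio mu sig2 mu' sig2' N z))) A" .
qed

text \<open>The two sums are kept apart on purpose: the first contains only errors of the primed
  model, later the optimum, and is integrable; the second consists of nonnegative errors of the
  competitor, whose means may be infinite.\<close>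

lemma ln_path_ratio:
  fixes mu mu' :: "nat \<Rightarrow> 'b::euclidean_space \<Rightarrow> 'b"
  assumes "\<forall>n\<in>{1..k}. 0 < sig2 n" "\<forall>n\<in>{1..k}. 0 < sig2' n"
  shows "ln (path_ratio mu sig2 mu' sig2' k z)
    = (\<Sum>n=1..k. real DIM('b) / 2 * ln (sig2 n / sig2' n) - (norm (z (n - 1) - mu' n (z n)))\<^sup>2 / (2 * sig2' n))
    + (\<Sum>n=1..k. (norm (z (n - 1) - mu n (z n)))\<^sup>2 / (2 * sig2 n))"
proof -
  have "ln (path_ratio mu sig2 mu' sig2' k z) = (\<Sum>n=1..k. ln (gauss_dens (mu' n (z n)) (sig2' n) (z (n - 1)) / gauss_dens (mu n (z n)) (sig2 n) (z (n - 1))))"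
    unfolding path_ratio_def by (rule ln_prod) (use assms in \<open>auto simp: gauss_dens_pos[THEN less_imp_neq, THEN not_sym]\<close>)
  also have "\<dots> = (\<Sum>n=1..k. (real DIM('b) / 2 * ln (sig2 n / sig2' n) - (norm (z (n - 1) - mu' n (z n)))\<^sup>2 / (2 * sig2' n))
      + (norm (z (n - 1) - mu n (z n)))\<^sup>2 / (2 * sig2 n))"
  proof (rule sum.cong)
    fix n assume "n \<in> {1..k}"
    then have pos: "0 < sig2 n" "0 < sig2' n" using assms by auto
    have "ln (2 * pi * sig2 n) - ln (2 * pi * sig2' n) = ln (sig2 n / sig2' n)"
      using pos by (simp add: ln_mult_pos ln_divide_pos)
    then have "real DIM('b) / 2 * ln (2 * pi * sig2 n) - real DIM('b) / 2 * ln (2 * pi * sig2' n) = real DIM('b) / 2 * ln (sig2 n / sig2' n)"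
      by (simp only: right_diff_distrib[symmetric])
    then show "ln (gauss_dens (mu' n (z n)) (sig2' n) (z (n - 1)) / gauss_dens (mu n (z n)) (sig2 n) (z (n - 1)))
      = real DIM('b) / 2 * ln (sig2 n / sig2' n) - (norm (z (n - 1) - mu' n (z n)))\<^sup>2 / (2 * sig2' n)
        + (norm (z (n - 1) - mu n (z n)))\<^sup>2 / (2 * sig2 n)"
      unfolding ln_divide_pos[OF gauss_dens_pos[OF pos(2)] gauss_dens_pos[OF pos(1)]] ln_gauss_dens[OF pos(1)] ln_gauss_dens[OF pos(2)]
      by linarith
  qed simp
  finally show ?thesis by (simp add: sum.distrib)
qed

subsection \<open>Comparing divergences\<close>

lemma kl_f_nonneg: "0 \<le> t \<Longrightarrow> 0 \<le> kl_f t"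
proof (cases "t = 0")
  case False
  assume "0 \<le> t"
  with False have t: "0 < t" by simp
  have "ln (1 / t) \<le> 1 / t - 1" using t by (intro ln_le_minus_one) simp
  then have "t * - ln t \<le> t * (1 / t - 1)" using t by (intro mult_left_mono) (simp_all add: ln_div)
  then show ?thesis using t by (simp add: kl_f_def algebra_simps)
qed (simp add: kl_f_def)

lemma borel_measurable_kl_f [measurable]: "kl_f \<in> borel_measurable borel"
  unfolding kl_f_def by measurable

text \<open>Only the log-likelihood ratio of the two models enters the comparison, so neither divergence has
  to be split into an entropy and a cross entropy, which may both be infinite.\<close>

lemma KL_density_le:
  fixes P Q :: "'b measure" and r l :: "'b \<Rightarrow> real"
  assumes P: "prob_space P" and Q: "prob_space Q" and PR: "prob_space (density P (\<lambda>x. ennreal (r x)))"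
    and r[measurable]: "r \<in> borel_measurable P" and r_pos: "\<And>x. 0 < r x"
    and l: "integrable Q l" and l_le: "\<And>x. l x \<le> ln (r x)"
    and ln_r: "integrable Q (\<lambda>x. ln (r x)) \<Longrightarrow> 0 \<le> (\<integral>x. ln (r x) \<partial>Q)"
  shows "KL Q (density P (\<lambda>x. ennreal (r x))) \<le> KL Q P"
\<comment> \<open>Outside this case the right-hand side is infinite; inside it, finiteness of
  \<open>KL Q P\<close> supplies the only integrability at hand besides that of
  \<open>l\<close>.\<close>
proof (cases "absolutely_continuous P Q \<and> sets Q = sets P \<and> KL Q P \<noteq> \<infinity>")
  case False
  then have "KL Q P = \<infinity>" by (auto simp: KL_def)
  then show ?thesis by simp
next
  case True
  interpret P: prob_space P by (rule P)
  interpret Q: prob_space Q by (rule Q)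
  interpret R: prob_space "density P (\<lambda>x. ennreal (r x))" by (rule PR)
  let ?P' = "density P (\<lambda>x. ennreal (r x))"
  define g where "g x = enn2real (RN_deriv P Q x)" for x
  have [measurable]: "g \<in> borel_measurable P" unfolding g_def by measurable
  have sets_Q: "sets Q = sets P" and ac: "absolutely_continuous P Q" using True by auto
  note [measurable_cong] = sets_Q
  have g_nonneg: "0 \<le> g x" for x by (simp add: g_def)
  have RN: "AE x in P. RN_deriv P Q x = ennreal (g x)"
    using P.RN_deriv_finite[OF _ ac sets_Q] Q.sigma_finite_measure_axioms
    unfolding g_def by (auto simp: less_top)
  have Q_eq: "Q = density P (\<lambda>x. ennreal (g x))"
    using P.density_RN_deriv[OF ac sets_Q] density_cong[OF _ _ RN] by simp
  \<comment> \<open>Chain rule for densities: as \<open>r\<close> never vanishes, \<open>Q\<close>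
    has density \<open>g / r\<close> relative to the new model.\<close>
  have Q_eq': "Q = density ?P' (\<lambda>x. ennreal (g x / r x))"
  proof -
    have "density ?P' (\<lambda>x. ennreal (g x / r x)) = density P (\<lambda>x. ennreal (r x) * ennreal (g x / r x))"
      by (rule density_density_eq) auto
    also have "\<dots> = Q"
      unfolding Q_eq using r_pos g_nonneg
      by (intro density_cong) (auto simp: ennreal_mult[symmetric] less_imp_le less_imp_neq[THEN not_sym])
    finally show ?thesis by simp
  qed
  have ac': "absolutely_continuous ?P' Q"
    by (subst Q_eq') (auto intro!: absolutely_continuousI_density)
  have RN': "AE x in ?P'. ennreal (g x / r x) = RN_deriv ?P' Q x"
    using Q_eq' by (intro R.RN_deriv_unique) auto
  have RN'_P: "AE x in P. ennreal (g x / r x) = RN_deriv ?P' Q x"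
    using RN' r_pos by (subst (asm) AE_density) auto
  define A where "A x = kl_f (g x)" for x
  define B where "B x = r x * kl_f (g x / r x)" for x
  have [measurable]: "A \<in> borel_measurable P" "B \<in> borel_measurable P"
    unfolding A_def B_def by measurable
  have A_nonneg: "0 \<le> A x" and B_nonneg: "0 \<le> B x" for x
    using r_pos[of x] g_nonneg[of x] by (auto simp: A_def B_def intro!: kl_f_nonneg mult_nonneg_nonneg)
  have KL_P: "KL Q P = (\<integral>\<^sup>+x. ennreal (A x) \<partial>P)"
    using ac sets_Q by (simp add: KL_def A_def g_def)
  have KL_P': "KL Q ?P' = (\<integral>\<^sup>+x. ennreal (B x) \<partial>P)"
  proof -
    have "KL Q ?P' = (\<integral>\<^sup>+x. ennreal (kl_f (enn2real (RN_deriv ?P' Q x))) \<partial>?P')"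
      using ac' sets_Q by (simp add: KL_def)
    also have "\<dots> = (\<integral>\<^sup>+x. ennreal (kl_f (g x / r x)) \<partial>?P')"
    proof (rule nn_integral_cong_AE)
      show "AE x in ?P'. ennreal (kl_f (enn2real (RN_deriv ?P' Q x))) = ennreal (kl_f (g x / r x))"
        using RN' by eventually_elim (metis enn2real_ennreal divide_nonneg_nonneg g_nonneg less_imp_le r_pos)
    qed
    also have "\<dots> = (\<integral>\<^sup>+x. ennreal (r x) * ennreal (kl_f (g x / r x)) \<partial>P)"
      by (rule nn_integral_density) auto
    also have "\<dots> = (\<integral>\<^sup>+x. ennreal (B x) \<partial>P)"
      unfolding B_def using r_pos g_nonneg kl_f_nonneg by (simp add: ennreal_mult less_imp_le)
    finally show ?thesis .
  qed
  have r_int: "integrable P r" "(\<integral>x. r x \<partial>P) = 1"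
  proof -
    have "(\<integral>\<^sup>+x. ennreal (r x) \<partial>P) = 1"
      using R.emeasure_space_1 by (simp add: emeasure_density cong: nn_integral_cong)
    then have "has_bochner_integral P r 1"
      using r_pos by (intro has_bochner_integral_nn_integral) (auto simp: less_imp_le)
    then show "integrable P r" "(\<integral>x. r x \<partial>P) = 1" by (auto simp: has_bochner_integral_iff)
  qed
  \<comment> \<open>Expanding \<open>kl_f\<close> gives \<open>B = g * ln (g / r) - g + r\<close>
    and \<open>A = g * ln g - g + 1\<close>. The leftover \<open>r - 1\<close> has integral zero,
    both models being probability measures.\<close>
  have AB: "B x = A x - g x * ln (r x) - 1 + r x" for x
  proof (cases "g x = 0")
    case True then show ?thesis by (simp add: A_def B_def kl_f_def)
  next
    case False
    then have ln_eq: "ln (g x / r x) = ln (g x) - ln (r x)"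
      using r_pos[of x] g_nonneg[of x] by (simp add: ln_divide_pos less_le)
    show ?thesis using r_pos[of x] unfolding A_def B_def kl_f_def ln_eq by (simp add: field_simps)
  qed
  have A_int: "integrable P A"
    using True A_nonneg unfolding KL_P by (intro integrableI_nonneg) (auto simp: less_top)
  have [measurable]: "l \<in> borel_measurable P" using l sets_Q by (auto cong: measurable_cong_sets)
  have gl_int: "integrable P (\<lambda>x. g x * l x)"
    using l unfolding Q_eq by (subst (asm) integrable_density) (auto simp: g_nonneg)
  \<comment> \<open>The minorant \<open>l\<close> of \<open>ln r\<close> suffices:
    \<open>0 \<le> B \<le> A - g * l + r\<close>, and the right-hand side is integrable.\<close>
  have B_int: "integrable P B"
  proof (rule Bochner_Integration.integrable_bound)
    show "integrable P (\<lambda>x. A x - g x * l x + r x)" using A_int gl_int r_int by simp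
    have "g x * l x \<le> g x * ln (r x)" for x using g_nonneg l_le by (rule mult_left_mono[rotated])
    then have "B x \<le> A x - g x * l x + r x" for x unfolding AB by (smt (verit))
    then show "AE x in P. norm (B x) \<le> norm (A x - g x * l x + r x)"
      using B_nonneg by (intro AE_I2) (smt (verit) real_norm_def)
  qed simp
  \<comment> \<open>With \<open>A\<close> and \<open>B\<close> integrable, so is their difference;
    only at this point is \<open>ln r\<close> known to be integrable under \<open>Q\<close>, and the
    hypothesis \<open>ln_r\<close> becomes available.\<close>
  have g_ln: "integrable P (\<lambda>x. g x * ln (r x))"
  proof -
    have "integrable P (\<lambda>x. A x - B x - 1 + r x)" using A_int B_int r_int by simp
    then show ?thesis by (simp add: AB)
  qed
  have "0 \<le> (\<integral>x. ln (r x) \<partial>Q)"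
    using g_ln by (intro ln_r, unfold Q_eq) (subst integrable_density, auto simp: g_nonneg)
  also have "\<dots> = (\<integral>x. g x * ln (r x) \<partial>P)"
    unfolding Q_eq by (subst integral_density) (auto simp: g_nonneg)
  finally have "0 \<le> (\<integral>x. g x * ln (r x) \<partial>P)" .
  moreover have "(\<integral>x. B x \<partial>P) = (\<integral>x. A x \<partial>P) - (\<integral>x. g x * ln (r x) \<partial>P)"
    unfolding AB using A_int g_ln r_int by (simp add: P.prob_space)
  ultimately have "(\<integral>x. B x \<partial>P) \<le> (\<integral>x. A x \<partial>P)" by simp
  then show ?thesis
    unfolding KL_P KL_P' using A_int B_int A_nonneg B_nonneg
    by (simp add: nn_integral_eq_integral)
qed

subsection \<open>Gaussian mixtures and Tweedie's formula\<close>

lemma gauss_dens_le: "0 < s \<Longrightarrow> gauss_dens m s (x::'a::euclidean_space) \<le> (2 * pi * s) powr (- real DIM('a) / 2)"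
  unfolding gauss_dens_def by (rule mult_right_le_one_le) auto

text \<open>The remainder is uniform in the base point, which lets the gradient of a mixture pass under the
  integral without a domination argument.\<close>

lemma gauss_exp_taylor:
  fixes u h :: "'a::euclidean_space"
  assumes s: "0 < s"
  defines "e \<equiv> \<lambda>x::'a. exp (- (norm x)\<^sup>2 / (2 * s))"
  shows "\<bar>e (u + h) - e u + e u * (u \<bullet> h) / s\<bar> \<le> (norm h)\<^sup>2 / s"
proof -
  define A B C where "A = u \<bullet> u" "B = u \<bullet> h" "C = h \<bullet> h"
  define W where "W t = A + 2 * B * t + C * t\<^sup>2" for t
  define E where "E t = exp (- W t / (2 * s))" for t
  \<comment> \<open>\<open>W t\<close> is the squared norm of \<open>u + t *\<^sub>R h\<close>.
    \<open>D\<close> lists \<open>E\<close> with its first two derivatives for the Taylor formula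
    with Lagrange remainder on the segment from \<open>u\<close> to \<open>u + h\<close>.\<close>
  define D where "D = (\<lambda>m::nat. if m = 0 then E else if m = 1 then (\<lambda>t. - E t * (B + C * t) / s)
     else (\<lambda>t. E t * (((B + C * t) / s)\<^sup>2 - C / s)))"
  have W_eq: "W t = (norm (u + t *\<^sub>R h))\<^sup>2" for t
    unfolding power2_norm_eq_inner W_def A_B_C_def by (simp add: inner_add inner_commute power2_eq_square algebra_simps)
  have D1: "(E has_real_derivative - E t * (B + C * t) / s) (at t)" for t
    unfolding E_def W_def using s
    by (auto intro!: derivative_eq_intros simp: field_simps)
  have D2: "((\<lambda>t. - E t * (B + C * t) / s) has_real_derivative E t * (((B + C * t) / s)\<^sup>2 - C / s)) (at t)" for t
    using s by (auto intro!: derivative_eq_intros D1 simp: power2_eq_square field_simps)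
  have "\<forall>m t. m < 2 \<and> 0 \<le> t \<and> t \<le> 1 \<longrightarrow> DERIV (D m) t :> D (Suc m) t"
    using D1 D2 by (auto simp: D_def less_2_cases_iff)
  from Maclaurin2[of 1 D E 2, OF _ _ this]
  obtain t where t: "E 1 = (\<Sum>m<2. D m 0 / fact m * 1 ^ m) + D 2 t / fact 2 * 1 ^ 2"
    by (auto simp: D_def)
  have "(\<Sum>m<2. D m 0 / fact m * 1 ^ m) = E 0 - E 0 * B / s"
    by (simp add: D_def lessThan_nat_numeral numeral_2_eq_2)
  moreover have "D 2 t = E t * (((B + C * t) / s)\<^sup>2 - C / s)" by (simp add: D_def)
  ultimately have eq: "E 1 - E 0 + E 0 * B / s = E t * (((B + C * t) / s)\<^sup>2 - C / s) / 2"
    using t by (simp add: fact_2)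
  have E_bounds: "0 < E t" "E t \<le> 1" using s by (auto simp: E_def W_eq)
  have C: "0 \<le> C" by (simp add: A_B_C_def)
  \<comment> \<open>\<open>y \<le> exp y\<close> makes \<open>E t * W t\<close> bounded whatever
    \<open>u\<close> is: the Gaussian decay absorbs the quadratic growth of the second derivative,
    and the constant becomes independent of \<open>u\<close>.\<close>
  have "W t / (2 * s) \<le> exp (W t / (2 * s))"
    using exp_ge_add_one_self[of "W t / (2 * s)"] by linarith
  then have EW: "E t * W t \<le> 2 * s"
    using s by (simp add: E_def exp_minus field_simps)
  have "(B + C * t)\<^sup>2 \<le> W t * C"
  proof -
    have "B + C * t = (u + t *\<^sub>R h) \<bullet> h" by (simp add: A_B_C_def inner_add)
    then have "(B + C * t)\<^sup>2 \<le> (u + t *\<^sub>R h) \<bullet> (u + t *\<^sub>R h) * (h \<bullet> h)"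
      using Cauchy_Schwarz_ineq by metis
    then show ?thesis by (simp add: W_eq power2_norm_eq_inner A_B_C_def)
  qed
  then have "E t * (B + C * t)\<^sup>2 \<le> E t * (W t * C)"
    using E_bounds by simp
  also have "\<dots> \<le> 2 * s * C"
    using EW C mult_right_mono[of "E t * W t" "2 * s" C] by (simp add: mult.assoc)
  finally have "E t * (B + C * t)\<^sup>2 / s\<^sup>2 \<le> 2 * s * C / s\<^sup>2"
    using s by (intro divide_right_mono) auto
  then have 1: "E t * ((B + C * t) / s)\<^sup>2 \<le> 2 * C / s"
    using s by (simp add: power_divide power2_eq_square)
  have 2: "0 \<le> E t * ((B + C * t) / s)\<^sup>2" using E_bounds by simp
  have 3: "0 \<le> E t * (C / s)" "E t * (C / s) \<le> C / s"
    using E_bounds C s mult_right_mono[of "E t" 1 "C / s"] by auto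
  \<comment> \<open>The second derivative is a difference of two nonnegative terms, at most
    \<open>2 * C / s\<close> and \<open>C / s\<close>; the factor 1/2 of the remainder leaves
    \<open>C / s\<close>.\<close>
  have "\<bar>E 1 - E 0 + E 0 * B / s\<bar> \<le> C / s"
  proof -
    have "E t * (((B + C * t) / s)\<^sup>2 - C / s) = E t * ((B + C * t) / s)\<^sup>2 - E t * (C / s)"
      by (rule right_diff_distrib)
    moreover have "\<bar>(X - Y) / 2\<bar> \<le> c" if "0 \<le> X" "X \<le> 2 * c" "0 \<le> Y" "Y \<le> c" for X Y c :: real
      using that by (simp add: abs_le_iff)
    note this[OF 2 _ 3]
    ultimately show ?thesis unfolding eq using 1 by simp
  qed
  then show ?thesis
    by (simp add: E_def W_eq e_def A_B_C_def power2_norm_eq_inner)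
qed

lemma gauss_dens_taylor:
  fixes m x h :: "'a::euclidean_space"
  assumes s: "0 < s"
  shows "\<bar>gauss_dens m s (x + h) - gauss_dens m s x - h \<bullet> (gauss_dens m s x *\<^sub>R ((1 / s) *\<^sub>R (m - x)))\<bar>
    \<le> (2 * pi * s) powr (- real DIM('a) / 2) / s * (norm h)\<^sup>2"
proof -
  define Z where "Z = (2 * pi * s) powr (- real DIM('a) / 2)"
  define e where "e x = exp (- (norm x)\<^sup>2 / (2 * s))" for x :: 'a
  have g: "gauss_dens m s y = Z * e (y - m)" for y by (simp add: gauss_dens_def Z_def e_def)
  have "gauss_dens m s (x + h) - gauss_dens m s x - h \<bullet> (gauss_dens m s x *\<^sub>R ((1 / s) *\<^sub>R (m - x)))
     = Z * (e (x - m + h) - e (x - m) + e (x - m) * ((x - m) \<bullet> h) / s)"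
    unfolding g by (simp add: inner_diff inner_commute algebra_simps diff_divide_distrib)
  moreover have "\<bar>\<dots>\<bar> \<le> Z * ((norm h)\<^sup>2 / s)"
    unfolding abs_mult using gauss_exp_taylor[OF s, of "x - m" h] by (intro mult_mono) (auto simp: Z_def e_def)
  ultimately show ?thesis by (simp add: Z_def)
qed

section \<open>Gradients and the weighted bias-variance identity\<close>

lemma GDERIV_quadratic_bound:
  fixes f :: "'a::euclidean_space \<Rightarrow> real"
  assumes "\<And>h. \<bar>f (x + h) - f x - h \<bullet> G\<bar> \<le> c * (norm h)\<^sup>2"
  shows "GDERIV f x :> G"
  unfolding gderiv_def has_derivative_at
proof
  show "bounded_linear (\<lambda>h. h \<bullet> G)" by (rule bounded_linear_inner_left)
  have "isCont (\<lambda>h::'a. c * norm h) 0" by (intro continuous_intros)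
  then have lim: "((\<lambda>h::'a. c * norm h) \<longlongrightarrow> 0) (at 0)" by (simp add: isCont_def)
  have "norm (f (x + h) - f x - h \<bullet> G) / norm h \<le> c * norm h" if "h \<noteq> 0" for h
    using assms[of h] that by (simp add: divide_le_eq power2_eq_square mult.assoc)
  then show "(\<lambda>h. norm (f (x + h) - f x - h \<bullet> G) / norm h) \<midarrow>0\<rightarrow> 0"
    by (intro tendsto_sandwich[OF _ _ tendsto_const lim]) (auto simp: eventually_at_filter)
qed

text \<open>Pins down the Hilbert choice in \<open>score\<close> once one gradient has been
  exhibited.\<close>

lemma GDERIV_unique:
  fixes f :: "'a::euclidean_space \<Rightarrow> real"
  assumes "GDERIV f x :> g" "GDERIV f x :> g'"
  shows "g = g'"
proof -
  have "(\<lambda>h. h \<bullet> g) = (\<lambda>h. h \<bullet> g')"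
    using assms unfolding gderiv_def by (rule has_derivative_unique)
  then show ?thesis by (metis inner_commute vector_eq_rdot)
qed

text \<open>The cross term vanishes because \<open>M\<close> is the centre of mass of
  \<open>w\<close>. The weight is not normalised, so the joint density at a fixed noisy state can be
  used as it stands.\<close>

lemma nn_integral_bias_variance:
  fixes w :: "'a::euclidean_space \<Rightarrow> real" and v :: 'a
  assumes w: "\<And>y. 0 \<le> w y" and w_int: "integrable lborel w"
    and w_sq: "integrable lborel (\<lambda>y. w y * (norm y)\<^sup>2)"
    and q: "0 < (\<integral>y. w y \<partial>lborel)"
  defines "M \<equiv> (1 / (\<integral>y. w y \<partial>lborel)) *\<^sub>R (\<integral>y. w y *\<^sub>R y \<partial>lborel)"
  shows "(\<integral>\<^sup>+y. ennreal (w y * (norm (y - v))\<^sup>2) \<partial>lborel)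
    = (\<integral>\<^sup>+y. ennreal (w y * (norm (y - M))\<^sup>2) \<partial>lborel) + ennreal ((\<integral>y. w y \<partial>lborel) * (norm (M - v))\<^sup>2)"
proof -
  have [measurable]: "w \<in> borel_measurable lborel" using w_int by auto
  have w_y: "integrable lborel (\<lambda>y. w y *\<^sub>R y)"
  proof (rule Bochner_Integration.integrable_bound)
    show "integrable lborel (\<lambda>y. w y + w y * (norm y)\<^sup>2)" using w_int w_sq by simp
    \<comment> \<open>Follows from the square of \<open>norm y - 1/2\<close> being nonnegative; mass
      and second moment thus control the first moment.\<close>
    have "norm y \<le> 1 + (norm y)\<^sup>2" for y :: 'a
      using sum_power2_ge_zero[of "norm y - 1/2" 0] by (simp add: power2_eq_square algebra_simps)
    then have "w y * norm y \<le> w y * (1 + (norm y)\<^sup>2)" for y using w by (intro mult_left_mono)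
    then show "AE y in lborel. norm (w y *\<^sub>R y) \<le> norm (w y + w y * (norm y)\<^sup>2)"
      using w by (intro AE_I2) (simp add: distrib_left)
  qed simp
  have inner: "integrable lborel (\<lambda>y. w y * (y \<bullet> u))"
    "(\<integral>y. w y * (y \<bullet> u) \<partial>lborel) = (\<integral>y. w y *\<^sub>R y \<partial>lborel) \<bullet> u" for u
    using integrable_inner_left[of u, OF w_y] integral_inner_left[of u, OF w_y] by simp_all
  have expand: "w y * (norm (y - u))\<^sup>2 = w y * (norm y)\<^sup>2 - 2 * (w y * (y \<bullet> u)) + w y * (norm u)\<^sup>2" for y u
    unfolding power2_norm_eq_inner by (simp add: inner_diff inner_commute algebra_simps)
  have int: "integrable lborel (\<lambda>y. w y * (norm (y - u))\<^sup>2)" for u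
    unfolding expand using w_int w_sq inner(1) by simp
  have val: "(\<integral>y. w y * (norm (y - u))\<^sup>2 \<partial>lborel) = (\<integral>y. w y * (norm y)\<^sup>2 \<partial>lborel)
      - 2 * ((\<integral>y. w y *\<^sub>R y \<partial>lborel) \<bullet> u) + (\<integral>y. w y \<partial>lborel) * (norm u)\<^sup>2" for u
    unfolding expand using w_int w_sq inner by simp
  have "(\<integral>y. w y *\<^sub>R y \<partial>lborel) = (\<integral>y. w y \<partial>lborel) *\<^sub>R M"
    using q by (simp add: M_def)
  then have "(\<integral>y. w y * (norm (y - v))\<^sup>2 \<partial>lborel)
     = (\<integral>y. w y * (norm (y - M))\<^sup>2 \<partial>lborel) + (\<integral>y. w y \<partial>lborel) * (norm (M - v))\<^sup>2"
    unfolding val unfolding power2_norm_eq_inner by (simp add: inner_diff inner_commute algebra_simps)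
  then show ?thesis
    using int w q by (simp add: nn_integral_eq_integral integral_nonneg_AE flip: ennreal_plus)
qed

text \<open>A single noise level: y has density \<open>q0\<close> and x given y is N(a y, s). The
  forward process at step \<open>n\<close> has \<open>a = sqrt (abar beta n)\<close> and
  \<open>s = bbar beta n\<close>.\<close>

locale gaussian_mixture =
  fixes a s :: real and q0 :: "'a::euclidean_space \<Rightarrow> real"
  assumes a: "0 < a" and s: "0 < s"
    and q0_measurable [measurable]: "q0 \<in> borel_measurable borel"
    and q0_nonneg: "0 \<le> q0 x"
    and q0_mass: "(\<integral>\<^sup>+ x. ennreal (q0 x) \<partial>lborel) = 1"
    and q0_moment: "integrable lborel (\<lambda>x. q0 x * (norm x)\<^sup>2)"
begin

definition joint :: "'a \<Rightarrow> 'a \<Rightarrow> real" where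
  "joint y x = q0 y * gauss_dens (a *\<^sub>R y) s x"

definition mix :: "'a \<Rightarrow> real" where
  "mix x = (\<integral>y. joint y x \<partial>lborel)"

definition post_mean :: "'a \<Rightarrow> 'a" where
  "post_mean x = (1 / mix x) *\<^sub>R (\<integral>y. joint y x *\<^sub>R y \<partial>lborel)"

text \<open>Tweedie's formula is taken as the definition; that it gives the gradient of the
  log-density is \<open>ln_mix_GDERIV\<close>.\<close>

definition mix_score :: "'a \<Rightarrow> 'a" where
  "mix_score x = (1 / s) *\<^sub>R (a *\<^sub>R post_mean x - x)"

lemma borel_measurable_joint [measurable (raw)]:
  assumes [measurable]: "f \<in> borel_measurable M" "g \<in> borel_measurable M"
  shows "(\<lambda>x. joint (f x) (g x)) \<in> borel_measurable M"
  unfolding joint_def by measurable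

lemma borel_measurable_mix [measurable]: "mix \<in> borel_measurable borel"
  unfolding mix_def by measurable

lemma borel_measurable_post_mean [measurable]: "post_mean \<in> borel_measurable borel"
  unfolding post_mean_def by measurable

lemma borel_measurable_mix_score [measurable]: "mix_score \<in> borel_measurable borel"
  unfolding mix_score_def by measurable

lemma joint_nonneg: "0 \<le> joint y x"
  using q0_nonneg by (simp add: joint_def)

lemma q0_integrable: "integrable lborel q0" and q0_integral: "(\<integral>y. q0 y \<partial>lborel) = 1"
proof -
  have "has_bochner_integral lborel q0 1"
    using q0_nonneg q0_mass by (intro has_bochner_integral_nn_integral) auto
  then show "integrable lborel q0" "(\<integral>y. q0 y \<partial>lborel) = 1" by (auto simp: has_bochner_integral_iff)
qed

lemma joint_le: "joint y x \<le> (2 * pi * s) powr (- real DIM('a) / 2) * q0 y"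
  unfolding joint_def using gauss_dens_le[OF s] q0_nonneg by (subst mult.commute) (intro mult_right_mono)

lemma joint_integrable: "integrable lborel (\<lambda>y. joint y x)"
proof (rule Bochner_Integration.integrable_bound)
  show "integrable lborel (\<lambda>y. (2 * pi * s) powr (- real DIM('a) / 2) * q0 y)"
    using q0_integrable by (rule integrable_mult_right)
  show "AE y in lborel. norm (joint y x) \<le> norm ((2 * pi * s) powr (- real DIM('a) / 2) * q0 y)"
    using joint_nonneg[of _ x] joint_le[of _ x] q0_nonneg by (intro AE_I2) (simp add: abs_mult)
qed simp

lemma joint_moment: "integrable lborel (\<lambda>y. joint y x * (norm y)\<^sup>2)"
proof (rule Bochner_Integration.integrable_bound[OF integrable_mult_right[OF q0_moment]])
  have "joint y x * (norm y)\<^sup>2 \<le> (2 * pi * s) powr (- real DIM('a) / 2) * (q0 y * (norm y)\<^sup>2)" for y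
    using mult_right_mono[OF joint_le, of "(norm y)\<^sup>2" y x] by (simp add: mult.assoc)
  then show "AE y in lborel. norm (joint y x * (norm y)\<^sup>2) \<le> norm ((2 * pi * s) powr (- real DIM('a) / 2) * (q0 y * (norm y)\<^sup>2))"
    using joint_nonneg q0_nonneg by (intro AE_I2) (simp add: abs_mult)
qed simp

lemma joint_mean: "integrable lborel (\<lambda>y. joint y x *\<^sub>R y)"
proof (rule Bochner_Integration.integrable_bound)
  show "integrable lborel (\<lambda>y. joint y x + joint y x * (norm y)\<^sup>2)" using joint_integrable joint_moment by simp
  have "norm y \<le> 1 + (norm y)\<^sup>2" for y :: 'a
    using sum_power2_ge_zero[of "norm y - 1/2" 0] by (simp add: power2_eq_square algebra_simps)
  then have "joint y x * norm y \<le> joint y x * (1 + (norm y)\<^sup>2)" for y using joint_nonneg by (intro mult_left_mono)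
  then show "AE y in lborel. norm (joint y x *\<^sub>R y) \<le> norm (joint y x + joint y x * (norm y)\<^sup>2)"
    using joint_nonneg by (intro AE_I2) (simp add: distrib_left)
qed simp

lemma not_AE_q0_zero: "\<not> (AE y in lborel. q0 y = 0)"
proof
  assume "AE y in lborel. q0 y = 0"
  then have "(\<integral>\<^sup>+ x. ennreal (q0 x) \<partial>lborel) = (\<integral>\<^sup>+ x. 0 \<partial>(lborel :: 'a measure))"
    by (intro nn_integral_cong_AE) auto
  then show False using q0_mass by simp
qed

text \<open>The Gaussian factor is positive everywhere, so a zero of the mixture would force
  \<open>q0\<close> to vanish almost everywhere.\<close>

lemma mix_pos: "0 < mix x"
proof (rule ccontr)
  assume "\<not> 0 < mix x"
  moreover have "0 \<le> mix x" unfolding mix_def by (intro integral_nonneg_AE AE_I2 joint_nonneg)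
  ultimately have "mix x = 0" by simp
  then have "AE y in lborel. joint y x = 0"
    unfolding mix_def using integral_nonneg_eq_0_iff_AE[OF joint_integrable] joint_nonneg by simp
  then have "AE y in lborel. q0 y = 0"
    by eventually_elim (use gauss_dens_pos[OF s] in \<open>auto simp: joint_def less_le\<close>)
  then show False using not_AE_q0_zero by simp
qed

text \<open>The Taylor estimate of the Gaussian is integrated against \<open>q0\<close>; its
  remainder does not depend on y and \<open>q0\<close> has mass 1, so the same quadratic bound holds
  for the mixture.\<close>

lemma mix_GDERIV: "GDERIV mix x :> mix x *\<^sub>R mix_score x"
proof (rule GDERIV_quadratic_bound)
  fix h :: 'a
  define Z where "Z = (2 * pi * s) powr (- real DIM('a) / 2) / s"
  \<comment> \<open>The pointwise gradient \<open>joint y x\<close> times (a y - x) / s, split into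
    two separately integrable parts.\<close>
  define W where "W y = (a / s) *\<^sub>R (joint y x *\<^sub>R y) - joint y x *\<^sub>R ((1 / s) *\<^sub>R x)" for y
  have W: "integrable lborel W"
    unfolding W_def
    by (intro Bochner_Integration.integrable_diff integrable_scaleR_right integrable_scaleR_left joint_mean joint_integrable)
  have "(\<integral>y. W y \<partial>lborel) = (\<integral>y. (a / s) *\<^sub>R (joint y x *\<^sub>R y) \<partial>lborel) - (\<integral>y. joint y x *\<^sub>R ((1 / s) *\<^sub>R x) \<partial>lborel)"
    unfolding W_def
    by (intro Bochner_Integration.integral_diff integrable_scaleR_right integrable_scaleR_left joint_mean joint_integrable)
  also have "\<dots> = (a / s) *\<^sub>R (\<integral>y. joint y x *\<^sub>R y \<partial>lborel) - mix x *\<^sub>R ((1 / s) *\<^sub>R x)"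
    by (simp only: integral_scaleR_right integral_scaleR_left[OF joint_integrable] mix_def)
  also have "\<dots> = mix x *\<^sub>R mix_score x"
    using mix_pos[of x] by (simp add: mix_score_def post_mean_def scaleR_diff_right)
  finally have W_int: "(\<integral>y. W y \<partial>lborel) = mix x *\<^sub>R mix_score x" .
  have W_h: "integrable lborel (\<lambda>y. h \<bullet> W y)" "(\<integral>y. h \<bullet> W y \<partial>lborel) = h \<bullet> (mix x *\<^sub>R mix_score x)"
    using integrable_inner_right[of h, OF W] integral_inner_right[of h, OF W] W_int by simp_all
  have "mix (x + h) - mix x - h \<bullet> (mix x *\<^sub>R mix_score x)
     = (\<integral>y. joint y (x + h) - joint y x - h \<bullet> W y \<partial>lborel)"
    unfolding W_h(2)[symmetric] unfolding mix_def using joint_integrable W_h(1) by simp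
  also have "norm \<dots> \<le> (\<integral>y. q0 y * (Z * (norm h)\<^sup>2) \<partial>lborel)"
  proof (rule Bochner_Integration.integral_norm_bound_integral)
    show "integrable lborel (\<lambda>y. joint y (x + h) - joint y x - h \<bullet> W y)"
      using joint_integrable W_h(1) by simp
    show "integrable lborel (\<lambda>y. q0 y * (Z * (norm h)\<^sup>2))" using q0_integrable by simp
    fix y :: 'a
    let ?g = "gauss_dens (a *\<^sub>R y) s"
    have "joint y (x + h) - joint y x - h \<bullet> W y
       = q0 y * (?g (x + h) - ?g x - h \<bullet> (?g x *\<^sub>R ((1 / s) *\<^sub>R (a *\<^sub>R y - x))))"
      by (simp add: W_def joint_def inner_diff_right inner_scaleR_right algebra_simps diff_divide_distrib)
    then show "norm (joint y (x + h) - joint y x - h \<bullet> W y) \<le> q0 y * (Z * (norm h)\<^sup>2)"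
      using gauss_dens_taylor[OF s, of "a *\<^sub>R y" x h] q0_nonneg
      by (simp only: real_norm_def abs_mult abs_of_nonneg Z_def) (intro mult_left_mono)
  qed
  also have "\<dots> = Z * (norm h)\<^sup>2" using q0_integral by simp
  finally show "\<bar>mix (x + h) - mix x - h \<bullet> (mix x *\<^sub>R mix_score x)\<bar> \<le> Z * (norm h)\<^sup>2" by simp
qed

lemma ln_mix_GDERIV: "GDERIV (\<lambda>y. ln (mix y)) x :> mix_score x"
proof -
  have "GDERIV (\<lambda>y. ln (mix y)) x :> (1 / mix x) *\<^sub>R (mix x *\<^sub>R mix_score x)"
    by (rule GDERIV_DERIV_compose[OF mix_GDERIV]) (use DERIV_ln_divide[OF mix_pos] in simp)
  then show ?thesis using mix_pos[of x] by simp
qed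

text \<open>The mean squared distance of y from its posterior mean. It is
  \<open>ennreal\<close>-valued because finiteness only emerges from
  \<open>post_var_score\<close>.\<close>

definition post_var :: ennreal where
  "post_var = (\<integral>\<^sup>+x. (\<integral>\<^sup>+y. ennreal (joint y x * (norm (y - post_mean x))\<^sup>2) \<partial>lborel) \<partial>lborel)"

text \<open>Pythagoras for predicting k y from x: dividing by \<open>k\<close> reduces each fixed x
  to the bias-variance identity about the posterior mean. The predictor \<open>f\<close> may have
  infinite error.\<close>

lemma nn_integral_joint_affine:
  assumes f[measurable]: "f \<in> borel_measurable borel" and k: "k \<noteq> 0"
  shows "(\<integral>\<^sup>+y. (\<integral>\<^sup>+x. ennreal (joint y x * (norm (k *\<^sub>R y - f x))\<^sup>2) \<partial>lborel) \<partial>lborel)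
    = ennreal (k\<^sup>2) * post_var + (\<integral>\<^sup>+x. ennreal (mix x * (norm (k *\<^sub>R post_mean x - f x))\<^sup>2) \<partial>lborel)"
proof -
  have norm_k: "(norm (k *\<^sub>R z - f x))\<^sup>2 = k\<^sup>2 * (norm (z - (1 / k) *\<^sub>R f x))\<^sup>2" for z x
  proof -
    have "k *\<^sub>R z - f x = k *\<^sub>R (z - (1 / k) *\<^sub>R f x)" using k by (simp add: scaleR_diff_right)
    then show ?thesis by (simp only: norm_scaleR power_mult_distrib power2_abs)
  qed
  have "(\<integral>\<^sup>+y. (\<integral>\<^sup>+x. ennreal (joint y x * (norm (k *\<^sub>R y - f x))\<^sup>2) \<partial>lborel) \<partial>lborel)
     = (\<integral>\<^sup>+x. (\<integral>\<^sup>+y. ennreal (joint y x * (norm (k *\<^sub>R y - f x))\<^sup>2) \<partial>lborel) \<partial>lborel)"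
    by (rule lborel_pair.Fubini'[symmetric]) simp
  also have "\<dots> = (\<integral>\<^sup>+x. ennreal (k\<^sup>2) * (\<integral>\<^sup>+y. ennreal (joint y x * (norm (y - post_mean x))\<^sup>2) \<partial>lborel)
      + ennreal (mix x * (norm (k *\<^sub>R post_mean x - f x))\<^sup>2) \<partial>lborel)"
  proof (rule nn_integral_cong)
    fix x
    have "(\<integral>\<^sup>+y. ennreal (joint y x * (norm (k *\<^sub>R y - f x))\<^sup>2) \<partial>lborel)
      = (\<integral>\<^sup>+y. ennreal (k\<^sup>2) * ennreal (joint y x * (norm (y - (1 / k) *\<^sub>R f x))\<^sup>2) \<partial>lborel)"
      unfolding norm_k by (simp add: ennreal_mult[symmetric] joint_nonneg mult_ac)
    also have "\<dots> = ennreal (k\<^sup>2) * (\<integral>\<^sup>+y. ennreal (joint y x * (norm (y - (1 / k) *\<^sub>R f x))\<^sup>2) \<partial>lborel)"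
      by (rule nn_integral_cmult) simp
    also have "(\<integral>\<^sup>+y. ennreal (joint y x * (norm (y - (1 / k) *\<^sub>R f x))\<^sup>2) \<partial>lborel)
      = (\<integral>\<^sup>+y. ennreal (joint y x * (norm (y - post_mean x))\<^sup>2) \<partial>lborel) + ennreal (mix x * (norm (post_mean x - (1 / k) *\<^sub>R f x))\<^sup>2)"
      unfolding post_mean_def mix_def using mix_pos[of x]
      by (intro nn_integral_bias_variance joint_nonneg joint_integrable joint_moment) (simp add: mix_def)
    also have "ennreal (k\<^sup>2) * \<dots> = ennreal (k\<^sup>2) * (\<integral>\<^sup>+y. ennreal (joint y x * (norm (y - post_mean x))\<^sup>2) \<partial>lborel)
      + ennreal (mix x * (norm (k *\<^sub>R post_mean x - f x))\<^sup>2)"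
      unfolding norm_k distrib_left using mix_pos[of x] by (simp add: ennreal_mult[symmetric] less_imp_le mult_ac)
    finally show "(\<integral>\<^sup>+y. ennreal (joint y x * (norm (k *\<^sub>R y - f x))\<^sup>2) \<partial>lborel) = \<dots>" .
  qed
  also have "\<dots> = ennreal (k\<^sup>2) * post_var + (\<integral>\<^sup>+x. ennreal (mix x * (norm (k *\<^sub>R post_mean x - f x))\<^sup>2) \<partial>lborel)"
    unfolding post_var_def by (subst nn_integral_add) (auto simp: nn_integral_cmult)
  finally show ?thesis .
qed

text \<open>The instance \<open>k = a\<close>, \<open>f x = x\<close> of the Pythagorean identity.
  Its left-hand side is the energy of the noise x - a y, namely \<open>s\<close> per coordinate, and
  a times the posterior mean minus x is \<open>s\<close> times the score.\<close>

lemma post_var_score: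
  "ennreal (a\<^sup>2) * post_var + (\<integral>\<^sup>+x. ennreal (mix x * (s\<^sup>2 * (norm (mix_score x))\<^sup>2)) \<partial>lborel) = ennreal (real DIM('a) * s)"
proof -
  have score: "s\<^sup>2 * (norm (mix_score x))\<^sup>2 = (norm (a *\<^sub>R post_mean x - x))\<^sup>2" for x
    using s by (simp add: mix_score_def power_divide)
  have "(\<integral>\<^sup>+x. ennreal (joint y x * (norm (a *\<^sub>R y - x))\<^sup>2) \<partial>lborel) = ennreal (real DIM('a) * s) * ennreal (q0 y)" for y
  proof -
    have "(\<integral>\<^sup>+x. ennreal (joint y x * (norm (a *\<^sub>R y - x))\<^sup>2) \<partial>lborel)
      = (\<integral>\<^sup>+x. ennreal (q0 y) * (ennreal (gauss_dens (a *\<^sub>R y) s x) * ennreal ((norm (x - a *\<^sub>R y))\<^sup>2)) \<partial>lborel)"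
      by (simp add: joint_def ennreal_mult q0_nonneg mult.assoc norm_minus_commute)
    also have "\<dots> = ennreal (q0 y) * ennreal (real DIM('a) * s)"
      using s by (subst nn_integral_cmult) (simp_all add: nn_integral_gauss_dens_sq)
    finally show ?thesis by (simp add: mult.commute)
  qed
  then have "(\<integral>\<^sup>+y. (\<integral>\<^sup>+x. ennreal (joint y x * (norm (a *\<^sub>R y - x))\<^sup>2) \<partial>lborel) \<partial>lborel) = ennreal (real DIM('a) * s)"
    by (simp add: nn_integral_cmult q0_mass)
  then show ?thesis
    unfolding score using nn_integral_joint_affine[of "\<lambda>x. x" a] a by simp
qed

text \<open>Zero variance would concentrate the posterior at one point for some x, whereas it has a
  density. This keeps the optimal variance admissible when \<open>lam n = 0\<close>.\<close>

lemma post_var_pos: "0 < post_var"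
proof (rule ccontr)
  assume "\<not> 0 < post_var"
  then have "post_var = 0" by simp
  then have "AE x in lborel. (\<integral>\<^sup>+y. ennreal (joint y x * (norm (y - post_mean x))\<^sup>2) \<partial>lborel) = 0"
    unfolding post_var_def by (subst (asm) nn_integral_0_iff_AE) auto
  \<comment> \<open>Lebesgue measure is not the null measure, so a property holding almost
    everywhere holds somewhere.\<close>
  then have "\<exists>x. (\<integral>\<^sup>+y. ennreal (joint y x * (norm (y - post_mean x))\<^sup>2) \<partial>lborel) = 0"
    by (rule eventually_happens'[rotated]) (simp add: ae_filter_eq_bot_iff emeasure_lborel_UNIV)
  then obtain x where "(\<integral>\<^sup>+y. ennreal (joint y x * (norm (y - post_mean x))\<^sup>2) \<partial>lborel) = 0" ..
  then have "AE y in lborel. ennreal (joint y x * (norm (y - post_mean x))\<^sup>2) = 0"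
    by (subst (asm) nn_integral_0_iff_AE) auto
  moreover have "AE y in lborel. y \<noteq> post_mean x" by (rule AE_lborel_singleton)
  ultimately have "AE y in lborel. q0 y = 0"
  proof eventually_elim
    case (elim y)
    then show ?case using q0_nonneg[of y] gauss_dens_pos[OF s, of "a *\<^sub>R y" x]
      by (auto simp: joint_def mult_le_0_iff)
  qed
  then show False using not_AE_q0_zero by simp
qed

text \<open>Both summands in \<open>post_var_score\<close> add up to a finite number, hence are
  finite, and the identity can be solved for \<open>post_var\<close> in the reals.\<close>

lemma post_var_eq:
  "post_var = ennreal (real DIM('a) * s / a\<^sup>2 * (1 - s * (\<integral>x. mix x * (norm (mix_score x))\<^sup>2 / real DIM('a) \<partial>lborel)))"
proof -
  let ?I = "\<integral>\<^sup>+x. ennreal (mix x * (s\<^sup>2 * (norm (mix_score x))\<^sup>2)) \<partial>lborel"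
  have "ennreal (a\<^sup>2) * post_var + ?I < \<infinity>" unfolding post_var_score by simp
  then have fin: "ennreal (a\<^sup>2) * post_var < \<infinity>" "?I < \<infinity>"
    by (auto simp only: infinity_ennreal_def less_top[symmetric] ennreal_add_eq_top)
  have nonneg: "0 \<le> mix x * (s\<^sup>2 * (norm (mix_score x))\<^sup>2)" for x using mix_pos[of x] by simp
  define J where "J = (\<integral>x. mix x * (s\<^sup>2 * (norm (mix_score x))\<^sup>2) \<partial>lborel)"
  have "integrable lborel (\<lambda>x. mix x * (s\<^sup>2 * (norm (mix_score x))\<^sup>2))"
    using fin(2) nonneg by (intro integrableI_nonneg) auto
  then have I: "?I = ennreal J" unfolding J_def using nonneg by (intro nn_integral_eq_integral) auto
  have J0: "0 \<le> J" unfolding J_def using nonneg by (intro integral_nonneg_AE) simp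
  have "post_var < \<infinity>" using fin(1) a by (auto simp: ennreal_mult_less_top)
  then obtain v where v: "post_var = ennreal v" "0 \<le> v" by (cases post_var) auto
  have "a\<^sup>2 * v + J = real DIM('a) * s"
    using post_var_score s v J0 unfolding I by (simp add: ennreal_mult[symmetric] ennreal_plus[symmetric] del: ennreal_plus)
  moreover define L where "L = (\<integral>x. mix x * (norm (mix_score x))\<^sup>2 / real DIM('a) \<partial>lborel)"
  have "J = s\<^sup>2 * real DIM('a) * L"
    unfolding J_def L_def by (subst integral_mult_right_zero[symmetric]) (simp add: mult_ac)
  ultimately have "a\<^sup>2 * v = real DIM('a) * s * (1 - s * L)"
    by (simp add: power2_eq_square algebra_simps)
  then have "v = real DIM('a) * s / a\<^sup>2 * (1 - s * L)"
    using a by (simp add: field_simps)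
  then show ?thesis using v by (simp add: L_def)
qed

end

subsection \<open>The forward process\<close>

locale diffusion =
  fixes N :: nat and beta lam :: "nat \<Rightarrow> real" and q0 :: "'a::euclidean_space \<Rightarrow> real"
  assumes beta: "n \<in> {1..N} \<Longrightarrow> 0 < beta n \<and> beta n < 1"
    and lam: "n \<in> {1..N} \<Longrightarrow> 0 \<le> lam n \<and> (lam n)\<^sup>2 \<le> bbar beta (n - 1)"
    and q0_measurable [measurable]: "q0 \<in> borel_measurable borel"
    and q0_nonneg: "0 \<le> q0 x"
    and q0_mass: "(\<integral>\<^sup>+ x. ennreal (q0 x) \<partial>lborel) = 1"
    and q0_moment: "integrable lborel (\<lambda>x. q0 x * (norm x)\<^sup>2)"
begin

section \<open>The noise schedule\<close>

lemma abar_Suc: "abar beta (Suc n) = abar beta n * alpha_s beta (Suc n)"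
  by (simp add: abar_def)

lemma abar_pos: "n \<le> N \<Longrightarrow> 0 < abar beta n"
  unfolding abar_def using beta by (intro prod_pos) (auto simp: alpha_s_def)

lemma abar_le_1: "n \<le> N \<Longrightarrow> abar beta n \<le> 1"
  unfolding abar_def using beta by (intro prod_le_1) (auto simp: alpha_s_def less_imp_le)

lemma bbar_0 [simp]: "bbar beta 0 = 0"
  by (simp add: bbar_def abar_def)

lemma bbar_pos: "0 < n \<Longrightarrow> n \<le> N \<Longrightarrow> 0 < bbar beta n"
proof (cases n)
  case (Suc j)
  assume "n \<le> N"
  with Suc have "abar beta n < abar beta j * 1"
    unfolding Suc abar_Suc using beta[of "Suc j"] abar_pos[of j]
    by (intro mult_strict_left_mono) (auto simp: alpha_s_def)
  then show ?thesis using abar_le_1[of j] Suc \<open>n \<le> N\<close> by (simp add: bbar_def)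
qed simp

lemma bbar_nonneg: "n \<le> N \<Longrightarrow> 0 \<le> bbar beta n"
  using bbar_pos[of n] by (cases "n = 0") auto

lemma lam_1: "1 \<le> N \<Longrightarrow> lam 1 = 0"
  using lam[of 1] by simp

text \<open>The coefficients of \<open>mu_tilde\<close> are designed for this: given the initial
  state, the propagated variance \<open>bbar beta (n - 1) - (lam n)\<^sup>2\<close> and the fresh
  variance \<open>(lam n)\<^sup>2\<close> add up to the prescribed one. For \<open>n = 1\<close>
  that variance is 0, whence \<open>1 < n\<close>.\<close>

lemma nn_integral_gauss_mu_tilde:
  fixes f :: "'a \<Rightarrow> ennreal" and x0 :: 'a
  assumes f: "f \<in> borel_measurable borel" and n: "1 < n" "n \<le> N"
  shows "(\<integral>\<^sup>+w. (\<integral>\<^sup>+y. f y \<partial>gauss (mu_tilde beta lam n w x0) ((lam n)\<^sup>2)) \<partial>gauss (sqrt (abar beta n) *\<^sub>R x0) (bbar beta n))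
    = (\<integral>\<^sup>+y. f y \<partial>gauss (sqrt (abar beta (n - 1)) *\<^sub>R x0) (bbar beta (n - 1)))"
  unfolding mu_tilde_def
proof (rule nn_integral_gauss_gauss[OF f])
  show "0 < bbar beta n" "0 < bbar beta (n - 1)" using n bbar_pos by auto
  then show "bbar beta (n - 1) = (sqrt (bbar beta (n - 1) - (lam n)\<^sup>2) / sqrt (bbar beta n))\<^sup>2 * bbar beta n + (lam n)\<^sup>2"
    using lam[of n] n by (simp add: power_divide)
qed simp

text \<open>The path from which \<open>fwd_process\<close> launches the chain. The copies of
  \<open>w\<close> at coordinates 1 to \<open>N - 1\<close> are placeholders.\<close>

definition start :: "'a \<Rightarrow> 'a \<Rightarrow> nat \<Rightarrow> 'a" where
  "start x0 w = restrict (\<lambda>i. if i = 0 then x0 else w) {0..N}"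

lemma start_simps [simp]: "start x0 w 0 = x0" "0 < i \<Longrightarrow> i \<le> N \<Longrightarrow> start x0 w i = w"
  by (simp_all add: start_def)

lemma space_start [simp]: "start x0 w \<in> space (path_space N)"
  by (simp add: start_def space_path_restrict)

lemma measurable_start [measurable (raw)]:
  "f \<in> borel_measurable M \<Longrightarrow> g \<in> borel_measurable M \<Longrightarrow> (\<lambda>x. start (f x) (g x)) \<in> M \<rightarrow>\<^sub>M path_space N"
  unfolding start_def
proof (rule measurable_path_restrict)
  fix i assume "f \<in> borel_measurable M" "g \<in> borel_measurable M"
  then show "(\<lambda>x. if i = 0 then f x else g x) \<in> borel_measurable M" by (cases "i = 0") auto
qed

text \<open>Induction on the starting level, upwards from \<open>n\<close>: every step of the chain
  maps the conditional Gaussian marginal at its level to the one below, so the levels above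
  \<open>n\<close> integrate out.\<close>

lemma nn_integral_q_chain_pair:
  fixes F :: "'a \<Rightarrow> 'a \<Rightarrow> ennreal"
  assumes F[measurable]: "(\<lambda>(y, w). F y w) \<in> borel_measurable (borel \<Otimes>\<^sub>M borel)"
    and n: "1 \<le> n"
  shows "n \<le> k \<Longrightarrow> k \<le> N \<Longrightarrow>
    (\<integral>\<^sup>+w. (\<integral>\<^sup>+z. F (z (n - 1)) (z n) \<partial>q_chain N beta lam k (start x0 w)) \<partial>gauss (sqrt (abar beta k) *\<^sub>R x0) (bbar beta k))
    = (\<integral>\<^sup>+w. (\<integral>\<^sup>+y. F y w \<partial>gauss (mu_tilde beta lam n w x0) ((lam n)\<^sup>2)) \<partial>gauss (sqrt (abar beta n) *\<^sub>R x0) (bbar beta n))"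
proof (induction k rule: nat_induct_at_least)
  case base
  define f where "f z = F (z (n - 1)) (z n)" for z :: "nat \<Rightarrow> 'a"
  have f: "f \<in> borel_measurable (path_space N)"
    unfolding f_def using base by (intro borel_measurable_path_pair F)
  have "(\<integral>\<^sup>+z. f z \<partial>q_chain N beta lam n (start x0 w)) = (\<integral>\<^sup>+y. F y w \<partial>gauss (mu_tilde beta lam n w x0) ((lam n)\<^sup>2))" for w
  proof (cases "n = 1")
    case True
    \<comment> \<open>At level 1 the chain samples nothing, coordinate 0 being set already; the
      right-hand side agrees since \<open>lam 1 = 0\<close> makes its inner Gaussian the point mass
      at \<open>x0\<close>.\<close>
    have "mu_tilde beta lam (Suc 0) w x0 = x0" using lam_1 base n by (simp add: mu_tilde_def abar_def)
    then show ?thesis using True base f lam_1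
      by (simp add: nn_integral_return nn_integral_gauss f_def)
  next
    case False
    then obtain j where j: "n = Suc j" "0 < j" using n by (cases n) auto
    have "(\<integral>\<^sup>+z. f z \<partial>q_chain N beta lam n (start x0 w))
      = (\<integral>\<^sup>+y. (\<integral>\<^sup>+z. f z \<partial>q_chain N beta lam j ((start x0 w)(j := y)))
          \<partial>gauss (mu_tilde beta lam n w x0) ((lam n)\<^sup>2))"
      using j base by (simp only: j(1), subst nn_integral_q_chain_Suc[OF f]) auto
    also have "\<dots> = (\<integral>\<^sup>+y. f ((start x0 w)(j := y)) \<partial>gauss (mu_tilde beta lam n w x0) ((lam n)\<^sup>2))"
      using j base by (intro nn_integral_cong nn_integral_q_chain_eq f space_path_upd space_start) (auto simp: f_def)
    finally show ?thesis using j base by (simp add: f_def)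
  qed
  then show ?case by (simp add: f_def)
next
  case (Suc k)
  have k: "k \<le> N" "0 < k" "1 < Suc k" using Suc n by auto
  define f where "f z = F (z (n - 1)) (z n)" for z :: "nat \<Rightarrow> 'a"
  have f: "f \<in> borel_measurable (path_space N)"
    unfolding f_def using Suc by (intro borel_measurable_path_pair F) auto
  have dep: "f xs = f ys" if "\<forall>i\<le>k. xs i = ys i" for xs ys
    using that Suc.hyps by (simp add: f_def)
  define h where "h y = (\<integral>\<^sup>+z. f z \<partial>q_chain N beta lam k (start x0 y))" for y
  have h: "h \<in> borel_measurable borel"
    unfolding h_def using k by (intro borel_measurable_nn_integral_q_chain f) auto
  have "(\<integral>\<^sup>+z. f z \<partial>q_chain N beta lam (Suc k) (start x0 w))
      = (\<integral>\<^sup>+y. h y \<partial>gauss (mu_tilde beta lam (Suc k) w x0) ((lam (Suc k))\<^sup>2))" for w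
  proof -
    have "(\<integral>\<^sup>+z. f z \<partial>q_chain N beta lam (Suc k) (start x0 w))
      = (\<integral>\<^sup>+y. (\<integral>\<^sup>+z. f z \<partial>q_chain N beta lam k ((start x0 w)(k := y)))
          \<partial>gauss (mu_tilde beta lam (Suc k) w x0) ((lam (Suc k))\<^sup>2))"
      using k Suc by (subst nn_integral_q_chain_Suc[OF f]) auto
    \<comment> \<open>The updated path and \<open>start x0 y\<close> share the coordinates 0 and
      \<open>k\<close>. They may differ above \<open>k\<close>, which \<open>f\<close> does not
      read, and in the placeholders below.\<close>
    also have "\<dots> = (\<integral>\<^sup>+y. h y \<partial>gauss (mu_tilde beta lam (Suc k) w x0) ((lam (Suc k))\<^sup>2))"
      unfolding h_def using k Suc
      by (intro nn_integral_cong nn_integral_q_chain_cong[OF f dep order_refl] space_path_upd space_start) auto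
    finally show ?thesis .
  qed
  then have "(\<integral>\<^sup>+w. (\<integral>\<^sup>+z. f z \<partial>q_chain N beta lam (Suc k) (start x0 w)) \<partial>gauss (sqrt (abar beta (Suc k)) *\<^sub>R x0) (bbar beta (Suc k)))
     = (\<integral>\<^sup>+y. h y \<partial>gauss (sqrt (abar beta k) *\<^sub>R x0) (bbar beta k))"
    using nn_integral_gauss_mu_tilde[OF h k(3) Suc.prems] by simp
  then show ?case using Suc.IH k by (simp add: f_def h_def)
qed

section \<open>The forward law and its marginals on consecutive states\<close>

lemma measurable_fwd_kernel:
  shows "(\<lambda>(x0, w). q_chain N beta lam N (start x0 w)) \<in> lborel \<Otimes>\<^sub>M lborel \<rightarrow>\<^sub>M prob_algebra (path_space N)"
proof -
  have "(\<lambda>p. start (fst p) (snd p)) \<in> borel \<Otimes>\<^sub>M borel \<rightarrow>\<^sub>M (path_space N :: (nat \<Rightarrow> 'a) measure)"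
    by measurable
  from measurable_compose[OF this measurable_q_chain[of N N beta lam]] show ?thesis
    by (simp add: case_prod_beta cong: measurable_cong_sets)
qed

lemma measurable_fwd_kernel':
  shows "(\<lambda>x0. gauss (sqrt (abar beta N) *\<^sub>R x0) (bbar beta N) \<bind> (\<lambda>w. q_chain N beta lam N (start x0 w)))
    \<in> lborel \<rightarrow>\<^sub>M prob_algebra (path_space N)"
  by (rule measurable_bind_prob_space2[OF measurable_gauss measurable_fwd_kernel]) (auto simp: bbar_nonneg)

lemma q0_in_prob_algebra: "density lborel (\<lambda>x. ennreal (q0 x)) \<in> space (prob_algebra lborel)"
  by (auto simp: space_prob_algebra emeasure_density q0_mass intro!: prob_spaceI)

lemma prob_space_fwd: "prob_space (fwd_process N beta lam q0)"
  and sets_fwd: "sets (fwd_process N beta lam q0) = sets (path_space N)"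
  unfolding fwd_process_def start_def[symmetric]
  using prob_space_bind'[OF q0_in_prob_algebra measurable_fwd_kernel'] sets_bind'[OF q0_in_prob_algebra measurable_fwd_kernel']
  by auto

text \<open>The law of the initial state and two consecutive states. The state at \<open>n\<close>
  has a density given the initial one since \<open>bbar beta n > 0\<close>; the step below may be a
  point mass and stays a kernel.\<close>

lemma nn_integral_fwd_pair:
  fixes F :: "'a \<Rightarrow> 'a \<Rightarrow> ennreal"
  assumes F[measurable]: "(\<lambda>(y, w). F y w) \<in> borel_measurable (borel \<Otimes>\<^sub>M borel)"
    and n: "1 \<le> n" "n \<le> N"
  shows "(\<integral>\<^sup>+z. F (z (n - 1)) (z n) \<partial>fwd_process N beta lam q0)
    = (\<integral>\<^sup>+x0. ennreal (q0 x0) * (\<integral>\<^sup>+w. ennreal (gauss_dens (sqrt (abar beta n) *\<^sub>R x0) (bbar beta n) w)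
        * (\<integral>\<^sup>+y. F y w \<partial>gauss (mu_tilde beta lam n w x0) ((lam n)\<^sup>2)) \<partial>lborel) \<partial>lborel)"
proof -
  have f: "(\<lambda>z. F (z (n - 1)) (z n)) \<in> borel_measurable (path_space N)"
    using n by (intro borel_measurable_path_pair F)
  have k: "(\<lambda>w. q_chain N beta lam N (start x0 w)) \<in> gauss m s \<rightarrow>\<^sub>M subprob_algebra (path_space N)" for m :: 'a and s x0
    using measurable_compose[OF measurable_Pair1' measurable_fwd_kernel, of x0]
    by (intro measurable_gauss_kernel) simp
  define Phi where "Phi x0 = (\<integral>\<^sup>+w. ennreal (gauss_dens (sqrt (abar beta n) *\<^sub>R x0) (bbar beta n) w)
        * (\<integral>\<^sup>+y. F y w \<partial>gauss (mu_tilde beta lam n w x0) ((lam n)\<^sup>2)) \<partial>lborel)" for x0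
  have [measurable]: "Phi \<in> borel_measurable borel"
    unfolding Phi_def by measurable
  have "(\<integral>\<^sup>+z. F (z (n - 1)) (z n) \<partial>fwd_process N beta lam q0)
    = (\<integral>\<^sup>+x0. (\<integral>\<^sup>+z. F (z (n - 1)) (z n) \<partial>(gauss (sqrt (abar beta N) *\<^sub>R x0) (bbar beta N) \<bind> (\<lambda>w. q_chain N beta lam N (start x0 w))))
        \<partial>density lborel (\<lambda>x. ennreal (q0 x)))"
    unfolding fwd_process_def start_def[symmetric]
    by (rule nn_integral_bind[OF f]) (use measurable_prob_algebraD[OF measurable_fwd_kernel'] in \<open>simp cong: measurable_cong_sets\<close>)
  also have "\<dots> = (\<integral>\<^sup>+x0. Phi x0 \<partial>density lborel (\<lambda>x. ennreal (q0 x)))"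
  proof (rule nn_integral_cong)
    fix x0 :: 'a
    have [measurable]: "(\<lambda>w. \<integral>\<^sup>+y. F y w \<partial>gauss (mu_tilde beta lam n w x0) ((lam n)\<^sup>2)) \<in> borel_measurable borel"
      by measurable
    show "(\<integral>\<^sup>+z. F (z (n - 1)) (z n) \<partial>(gauss (sqrt (abar beta N) *\<^sub>R x0) (bbar beta N) \<bind> (\<lambda>w. q_chain N beta lam N (start x0 w)))) = Phi x0"
      using n bbar_pos[of n]
      unfolding nn_integral_bind[OF f k] nn_integral_q_chain_pair[OF F n order_refl] Phi_def
      by (subst nn_integral_gauss) auto
  qed
  also have "\<dots> = (\<integral>\<^sup>+x0. ennreal (q0 x0) * Phi x0 \<partial>lborel)"
    by (rule nn_integral_density) auto
  finally show ?thesis by (simp add: Phi_def)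
qed

lemma gaussian_mixture: "n \<in> {1..N} \<Longrightarrow> gaussian_mixture (sqrt (abar beta n)) (bbar beta n) q0"
  by unfold_locales (auto simp: abar_pos bbar_pos q0_nonneg q0_mass q0_moment)

text \<open>The coefficient of the initial state in \<open>mu_tilde\<close>.\<close>

definition gain :: "nat \<Rightarrow> real" where
  "gain n = sqrt (abar beta (n - 1)) - sqrt (bbar beta (n - 1) - (lam n)\<^sup>2) / sqrt (bbar beta n) * sqrt (abar beta n)"

lemma mu_tilde_eq_gain:
  "mu_tilde beta lam n w y = gain n *\<^sub>R y + (sqrt (bbar beta (n - 1) - (lam n)\<^sup>2) / sqrt (bbar beta n)) *\<^sub>R w"
  by (simp add: mu_tilde_def gain_def scaleR_diff_right scaleR_diff_left)

text \<open>After squaring, it suffices that \<open>abar beta j * bbar beta n - bbar beta j * abar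
  beta n = abar beta j * (1 - alpha_s beta n)\<close> is positive, where \<open>n = Suc j\<close>.
  Hence predicting the previous state amounts to predicting the initial one.\<close>

lemma gain_pos:
  assumes n: "n \<in> {1..N}"
  shows "0 < gain n"
proof -
  obtain j where j: "n = Suc j" using n by (cases n) auto
  have pos: "0 < abar beta j" "0 < abar beta n" "0 < bbar beta n" and a: "alpha_s beta n < 1"
    using n j beta[OF n] abar_pos bbar_pos by (auto simp: alpha_s_def)
  have "(bbar beta j - (lam n)\<^sup>2) * abar beta n \<le> bbar beta j * abar beta n"
    using pos by (intro mult_right_mono) auto
  also have "\<dots> < abar beta j * bbar beta n"
    using mult_strict_left_mono[OF a pos(1)] by (simp add: j abar_Suc bbar_def algebra_simps)
  finally have "sqrt (bbar beta j - (lam n)\<^sup>2) * sqrt (abar beta n) < sqrt (abar beta j) * sqrt (bbar beta n)"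
    unfolding real_sqrt_mult[symmetric] by (rule real_sqrt_less_mono)
  then show ?thesis using pos by (simp add: gain_def j field_simps)
qed

text \<open>Since \<open>alpha_s beta n\<close> is \<open>abar beta n / abar beta (n - 1)\<close>,
  the bracket in \<open>sigma2_star\<close> is \<open>gain n\<close> times the square root of
  \<open>bbar beta n / abar beta n\<close>, the scale s / a^2 of \<open>post_var_eq\<close>.\<close>

lemma gain_sq:
  assumes n: "n \<in> {1..N}"
  shows "(sqrt (bbar beta n / alpha_s beta n) - sqrt (bbar beta (n - 1) - (lam n)\<^sup>2))\<^sup>2
    = (gain n)\<^sup>2 * bbar beta n / abar beta n"
proof -
  obtain j where j: "n = Suc j" using n by (cases n) auto
  have pos: "0 < abar beta j" "0 < abar beta n" "0 < bbar beta n" "0 < alpha_s beta n"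
    using n j beta[OF n] abar_pos bbar_pos by (auto simp: alpha_s_def)
  have "sqrt (abar beta n) = sqrt (abar beta j) * sqrt (alpha_s beta n)"
    by (simp add: j abar_Suc real_sqrt_mult)
  then have eq: "sqrt (bbar beta n / alpha_s beta n) = sqrt (abar beta j) * sqrt (bbar beta n) / sqrt (abar beta n)"
    using pos by (simp add: real_sqrt_divide)
  have "n - 1 = j" using j by simp
  then have "sqrt (bbar beta n / alpha_s beta n) - sqrt (bbar beta (n - 1) - (lam n)\<^sup>2)
    = gain n * sqrt (bbar beta n) / sqrt (abar beta n)"
    using pos by (simp add: eq gain_def left_diff_distrib diff_divide_distrib)
  then show ?thesis using pos by (simp add: power_mult_distrib power_divide)
qed

section \<open>Optimal parameters and prediction error at a fixed step\<close>

context
  fixes n :: nat assumes n: "n \<in> {1..N}"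
begin

interpretation gm: gaussian_mixture "sqrt (abar beta n)" "bbar beta n" q0
  by (rule gaussian_mixture[OF n])

lemma q_marg_eq_mix: "q_marg beta q0 n = gm.mix"
  by (rule ext) (simp add: q_marg_def gm.mix_def gm.joint_def)

lemma score_eq_mix_score: "score beta q0 n = gm.mix_score"
  unfolding score_def q_marg_eq_mix
  by (rule ext, rule some_equality, rule gm.ln_mix_GDERIV, rule GDERIV_unique, assumption, rule gm.ln_mix_GDERIV)

text \<open>Tweedie's formula solved for the posterior mean: x + s times the score is a times that
  mean.\<close>

lemma mu_star_eq: "mu_star beta lam q0 n x = mu_tilde beta lam n x (gm.post_mean x)"
  using gm.a gm.s by (simp add: mu_star_def score_eq_mix_score gm.mix_score_def)

lemma borel_measurable_mu_star: "mu_star beta lam q0 n \<in> borel_measurable borel"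
  unfolding mu_star_eq by measurable

text \<open>Law of total variance: fresh noise \<open>(lam n)\<^sup>2\<close> in each of the d
  coordinates plus the posterior uncertainty of the initial state scaled by the gain.\<close>

lemma sigma2_star_eq_post_var:
  "ennreal (real DIM('a) * (lam n)\<^sup>2) + ennreal ((gain n)\<^sup>2) * gm.post_var = ennreal (real DIM('a) * sigma2_star beta lam q0 n)"
  and sigma2_star_pos: "0 < sigma2_star beta lam q0 n"
proof -
  define L where "L = (\<integral>x. gm.mix x * (norm (gm.mix_score x))\<^sup>2 / real DIM('a) \<partial>lborel)"
  have pos: "0 < abar beta n" "0 < bbar beta n" using n abar_pos bbar_pos by auto
  have V: "gm.post_var = ennreal (real DIM('a) * bbar beta n / abar beta n * (1 - bbar beta n * L))"
    unfolding gm.post_var_eq L_def using pos by simp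
  \<comment> \<open>\<open>ennreal\<close> truncates negative reals to 0, so the sign of the real
    expression has to be read off from positivity of \<open>post_var\<close>.\<close>
  then have X: "0 < real DIM('a) * bbar beta n / abar beta n * (1 - bbar beta n * L)"
    using gm.post_var_pos by (simp add: ennreal_less_zero_iff)
  have "0 < real DIM('a) * bbar beta n / abar beta n" using pos by simp
  with X have L: "0 < 1 - bbar beta n * L" by (rule zero_less_mult_pos)
  have sig: "sigma2_star beta lam q0 n = (lam n)\<^sup>2 + (gain n)\<^sup>2 * bbar beta n / abar beta n * (1 - bbar beta n * L)"
    unfolding sigma2_star_def gain_sq[OF n] q_marg_eq_mix score_eq_mix_score L_def ..
  show "0 < sigma2_star beta lam q0 n"
    unfolding sig using L pos gain_pos[OF n] by (intro add_nonneg_pos mult_pos_pos divide_pos_pos) auto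
  have "ennreal (real DIM('a) * (lam n)\<^sup>2) + ennreal ((gain n)\<^sup>2) * gm.post_var
    = ennreal (real DIM('a) * (lam n)\<^sup>2 + (gain n)\<^sup>2 * (real DIM('a) * bbar beta n / abar beta n * (1 - bbar beta n * L)))"
  proof -
    have "ennreal A + ennreal B * ennreal C = ennreal (A + B * C)" if "0 \<le> A" "0 \<le> B" "0 < C" for A B C :: real
      using that by (simp add: ennreal_mult)
    from this[OF _ _ X] show ?thesis unfolding V by simp
  qed
  also have "real DIM('a) * (lam n)\<^sup>2 + (gain n)\<^sup>2 * (real DIM('a) * bbar beta n / abar beta n * (1 - bbar beta n * L))
    = real DIM('a) * sigma2_star beta lam q0 n"
    unfolding sig by (simp add: algebra_simps)
  finally show "ennreal (real DIM('a) * (lam n)\<^sup>2) + ennreal ((gain n)\<^sup>2) * gm.post_var = ennreal (real DIM('a) * sigma2_star beta lam q0 n)" .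
qed

text \<open>Given the initial and the current state, the error is fresh noise plus the squared
  distance of \<open>mu_tilde\<close> from \<open>f\<close>, which is affine in the initial state;
  the Pythagorean identity then averages over that state.\<close>

lemma nn_integral_fwd_error:
  assumes f[measurable]: "f \<in> borel_measurable borel"
  shows "(\<integral>\<^sup>+z. ennreal ((norm (z (n - 1) - f (z n)))\<^sup>2) \<partial>fwd_process N beta lam q0)
    = ennreal (real DIM('a) * sigma2_star beta lam q0 n)
      + (\<integral>\<^sup>+x. ennreal (q_marg beta q0 n x * (norm (mu_star beta lam q0 n x - f x))\<^sup>2) \<partial>lborel)"
proof -
  define c where "c = sqrt (bbar beta (n - 1) - (lam n)\<^sup>2) / sqrt (bbar beta n)"
  \<comment> \<open>\<open>g\<close> absorbs the part of \<open>mu_tilde\<close> that is linear in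
    the current state.\<close>
  define g where "g x = f x - c *\<^sub>R x" for x
  have [measurable]: "g \<in> borel_measurable borel" unfolding g_def by measurable
  have mt: "mu_tilde beta lam n x y - f x = gain n *\<^sub>R y - g x" for x y
    by (simp add: mu_tilde_eq_gain g_def c_def)
  let ?G = "\<lambda>y. gauss_dens (sqrt (abar beta n) *\<^sub>R y) (bbar beta n)"
  let ?d = "real DIM('a) * (lam n)\<^sup>2"
  have "(\<integral>\<^sup>+z. ennreal ((norm (z (n - 1) - f (z n)))\<^sup>2) \<partial>fwd_process N beta lam q0)
    = (\<integral>\<^sup>+y. ennreal (q0 y) * (\<integral>\<^sup>+x. ennreal (?G y x)
        * (\<integral>\<^sup>+u. ennreal ((norm (u - f x))\<^sup>2) \<partial>gauss (mu_tilde beta lam n x y) ((lam n)\<^sup>2)) \<partial>lborel) \<partial>lborel)"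
    using n by (intro nn_integral_fwd_pair) auto
  also have "\<dots> = (\<integral>\<^sup>+y. ennreal ?d * ennreal (q0 y) + (\<integral>\<^sup>+x. ennreal (gm.joint y x * (norm (gain n *\<^sub>R y - g x))\<^sup>2) \<partial>lborel) \<partial>lborel)"
  proof (rule nn_integral_cong)
    fix y
    have "(\<integral>\<^sup>+x. ennreal (?G y x) * (\<integral>\<^sup>+u. ennreal ((norm (u - f x))\<^sup>2) \<partial>gauss (mu_tilde beta lam n x y) ((lam n)\<^sup>2)) \<partial>lborel)
      = (\<integral>\<^sup>+x. ennreal ?d * ennreal (?G y x) + ennreal (?G y x * (norm (gain n *\<^sub>R y - g x))\<^sup>2) \<partial>lborel)"
      by (simp add: nn_integral_gauss_sq mt ennreal_plus ennreal_mult distrib_left mult_ac)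
    also have "\<dots> = ennreal ?d + (\<integral>\<^sup>+x. ennreal (?G y x * (norm (gain n *\<^sub>R y - g x))\<^sup>2) \<partial>lborel)"
      using gm.s by (simp add: nn_integral_add nn_integral_cmult nn_integral_gauss_dens)
    finally have "ennreal (q0 y) * (\<integral>\<^sup>+x. ennreal (?G y x) * (\<integral>\<^sup>+u. ennreal ((norm (u - f x))\<^sup>2) \<partial>gauss (mu_tilde beta lam n x y) ((lam n)\<^sup>2)) \<partial>lborel)
      = ennreal ?d * ennreal (q0 y) + ennreal (q0 y) * (\<integral>\<^sup>+x. ennreal (?G y x * (norm (gain n *\<^sub>R y - g x))\<^sup>2) \<partial>lborel)"
      by (simp only: distrib_left mult.commute)
    also have "ennreal (q0 y) * (\<integral>\<^sup>+x. ennreal (?G y x * (norm (gain n *\<^sub>R y - g x))\<^sup>2) \<partial>lborel)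
      = (\<integral>\<^sup>+x. ennreal (gm.joint y x * (norm (gain n *\<^sub>R y - g x))\<^sup>2) \<partial>lborel)"
      by (subst nn_integral_cmult[symmetric]) (auto simp: gm.joint_def ennreal_mult q0_nonneg mult.assoc)
    finally show "ennreal (q0 y) * (\<integral>\<^sup>+x. ennreal (?G y x) * (\<integral>\<^sup>+u. ennreal ((norm (u - f x))\<^sup>2) \<partial>gauss (mu_tilde beta lam n x y) ((lam n)\<^sup>2)) \<partial>lborel)
      = ennreal ?d * ennreal (q0 y) + (\<integral>\<^sup>+x. ennreal (gm.joint y x * (norm (gain n *\<^sub>R y - g x))\<^sup>2) \<partial>lborel)" .
  qed
  also have "\<dots> = ennreal ?d + (\<integral>\<^sup>+y. (\<integral>\<^sup>+x. ennreal (gm.joint y x * (norm (gain n *\<^sub>R y - g x))\<^sup>2) \<partial>lborel) \<partial>lborel)"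
    by (subst nn_integral_add) (auto simp: nn_integral_cmult q0_mass)
  also have "\<dots> = ennreal ?d + (ennreal ((gain n)\<^sup>2) * gm.post_var
      + (\<integral>\<^sup>+x. ennreal (gm.mix x * (norm (gain n *\<^sub>R gm.post_mean x - g x))\<^sup>2) \<partial>lborel))"
    using gain_pos[OF n] by (subst gm.nn_integral_joint_affine) auto
  also have "\<dots> = ennreal (real DIM('a) * sigma2_star beta lam q0 n)
      + (\<integral>\<^sup>+x. ennreal (q_marg beta q0 n x * (norm (mu_star beta lam q0 n x - f x))\<^sup>2) \<partial>lborel)"
    unfolding mu_star_eq mt q_marg_eq_mix sigma2_star_eq_post_var[symmetric] by (simp only: add.assoc)
  finally show ?thesis .
qed

end

lemma KL_star_le:
  fixes mu :: "nat \<Rightarrow> 'a \<Rightarrow> 'a"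
  assumes mu: "\<forall>n\<in>{1..N}. mu n \<in> borel_measurable borel \<and> 0 < sig2 n"
  shows "KL (fwd_process N beta lam q0) (rev_model N (mu_star beta lam q0) (sigma2_star beta lam q0))
    \<le> KL (fwd_process N beta lam q0) (rev_model N mu sig2)"
proof -
  let ?Q = "fwd_process N beta lam q0"
  let ?mu = "mu_star beta lam q0" and ?sig = "sigma2_star beta lam q0"
  let ?R = "path_ratio mu sig2 ?mu ?sig N"
  let ?d = "real DIM('a)"
  interpret Q: prob_space ?Q by (rule prob_space_fwd)
  have star: "\<forall>n\<in>{1..N}. ?mu n \<in> borel_measurable borel \<and> 0 < ?sig n"
    using borel_measurable_mu_star sigma2_star_pos by blast
  define err where "err f n z = (norm (z (n - 1) - f (z n)))\<^sup>2" for f :: "'a \<Rightarrow> 'a" and n and z :: "nat \<Rightarrow> 'a"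
  have err_meas: "err f n \<in> borel_measurable ?Q" if "n \<in> {1..N}" "f \<in> borel_measurable borel" for f n
  proof -
    have [measurable]: "f \<in> borel_measurable borel" by fact
    have "err f n \<in> borel_measurable (path_space N)"
      unfolding err_def using that by (intro borel_measurable_path_pair[where F="\<lambda>y w. (norm (y - f w))\<^sup>2"]) auto
    then show ?thesis using sets_fwd by (simp cong: measurable_cong_sets)
  qed
  have err_star: "has_bochner_integral ?Q (err (?mu n) n) (?d * ?sig n)" if n: "n \<in> {1..N}" for n
  proof (rule has_bochner_integral_nn_integral)
    show "err (?mu n) n \<in> borel_measurable ?Q" using err_meas n star by auto
    show "(\<integral>\<^sup>+z. ennreal (err (?mu n) n z) \<partial>?Q) = ennreal (?d * ?sig n)"
      unfolding err_def using n star by (subst nn_integral_fwd_error) auto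
  qed (use n star in \<open>auto simp: err_def less_imp_le\<close>)
  have err_ge: "?d * ?sig n \<le> (\<integral>z. err f n z \<partial>?Q)"
    if n: "n \<in> {1..N}" and f: "f \<in> borel_measurable borel" and int: "integrable ?Q (err f n)" for f n
  proof -
    have "ennreal (?d * ?sig n) \<le> (\<integral>\<^sup>+z. ennreal (err f n z) \<partial>?Q)"
      unfolding err_def nn_integral_fwd_error[OF n f] by simp
    also have "\<dots> = ennreal (\<integral>z. err f n z \<partial>?Q)"
      using int by (rule nn_integral_eq_integral) (simp add: err_def)
    finally show ?thesis
      using integral_nonneg_AE[where M="?Q" and f="err f n"] by (simp add: err_def)
  qed
  \<comment> \<open>The log-ratio without the competitor's nonnegative errors; integrable because
    each optimal error has finite mean \<open>?d * ?sig n\<close>.\<close>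
  define l where "l z = (\<Sum>n=1..N. ?d / 2 * ln (sig2 n / ?sig n) - err (?mu n) n z / (2 * ?sig n))" for z
  have ln_R: "ln (?R z) = l z + (\<Sum>n=1..N. err (mu n) n z / (2 * sig2 n))" for z
    unfolding l_def err_def using mu star by (intro ln_path_ratio) auto
  have l_int: "integrable ?Q l"
    unfolding l_def using err_star by (intro Bochner_Integration.integrable_sum) (auto simp: has_bochner_integral_iff)
  have l_val: "(\<integral>z. l z \<partial>?Q) = (\<Sum>n=1..N. ?d / 2 * ln (sig2 n / ?sig n) - ?d / 2)"
  proof -
    have "(\<integral>z. l z \<partial>?Q) = (\<Sum>n=1..N. \<integral>z. ?d / 2 * ln (sig2 n / ?sig n) - err (?mu n) n z / (2 * ?sig n) \<partial>?Q)"
      unfolding l_def using err_star by (intro Bochner_Integration.integral_sum) (auto simp: has_bochner_integral_iff)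
    also have "\<dots> = (\<Sum>n=1..N. ?d / 2 * ln (sig2 n / ?sig n) - ?d / 2)"
    proof (rule sum.cong)
      fix n assume n: "n \<in> {1..N}"
      then have "integrable ?Q (err (?mu n) n)" "(\<integral>z. err (?mu n) n z \<partial>?Q) = ?d * ?sig n" "?sig n \<noteq> 0"
        using err_star[OF n] sigma2_star_pos[OF n] by (auto simp: has_bochner_integral_iff)
      then show "(\<integral>z. ?d / 2 * ln (sig2 n / ?sig n) - err (?mu n) n z / (2 * ?sig n) \<partial>?Q) = ?d / 2 * ln (sig2 n / ?sig n) - ?d / 2"
        by (simp add: Q.prob_space)
    qed simp
    finally show ?thesis .
  qed
  have "KL ?Q (density (rev_model N mu sig2) (\<lambda>z. ennreal (?R z))) \<le> KL ?Q (rev_model N mu sig2)"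
  proof (rule KL_density_le[OF _ prob_space_fwd _ _ _ l_int])
    show "prob_space (rev_model N mu sig2)"
      using rev_model_in_prob_algebra[OF mu] by (simp add: space_prob_algebra)
    show "prob_space (density (rev_model N mu sig2) (\<lambda>z. ennreal (?R z)))"
      using rev_model_in_prob_algebra[OF star] unfolding rev_model_change[OF mu star] by (simp add: space_prob_algebra)
    have "?R \<in> borel_measurable (path_space N)" using mu star by (intro borel_measurable_path_ratio) auto
    then show "?R \<in> borel_measurable (rev_model N mu sig2)"
      using rev_model_in_prob_algebra[OF mu] by (simp add: space_prob_algebra cong: measurable_cong_sets)
    show "0 < ?R z" for z using mu star by (intro path_ratio_pos) auto
    show "l z \<le> ln (?R z)" for z
      unfolding ln_R using mu by (auto intro!: sum_nonneg simp: err_def less_imp_le)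
    assume ln_int: "integrable ?Q (\<lambda>z. ln (?R z))"
    have sum_int: "integrable ?Q (\<lambda>z. \<Sum>n=1..N. err (mu n) n z / (2 * sig2 n))"
      using Bochner_Integration.integrable_diff[OF ln_int l_int] by (simp add: ln_R)
    \<comment> \<open>Integrability of the sum passes to each nonnegative summand by
      domination.\<close>
    have err_int: "integrable ?Q (\<lambda>z. err (mu n) n z / (2 * sig2 n))" if n: "n \<in> {1..N}" for n
    proof (rule Bochner_Integration.integrable_bound[OF sum_int])
      show "(\<lambda>z. err (mu n) n z / (2 * sig2 n)) \<in> borel_measurable ?Q"
        using err_meas n mu by (intro borel_measurable_divide) auto
      have nonneg: "0 \<le> err (mu m) m z / (2 * sig2 m)" if "m \<in> {1..N}" for m z
        using that mu by (auto simp: err_def less_imp_le)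
      have "err (mu n) n z / (2 * sig2 n) \<le> (\<Sum>m=1..N. err (mu m) m z / (2 * sig2 m))" for z
        using n nonneg by (intro member_le_sum) auto
      then show "AE z in ?Q. norm (err (mu n) n z / (2 * sig2 n)) \<le> norm (\<Sum>m=1..N. err (mu m) m z / (2 * sig2 m))"
        using nonneg[OF n] by (intro AE_I2) (smt (verit) real_norm_def)
    qed
    \<comment> \<open>Each summand is the divergence between centred Gaussians of variances
      \<open>?sig n\<close> and \<open>sig2 n\<close>, nonnegative by
      \<open>ln t \<le> t - 1\<close> at \<open>t = ?sig n / sig2 n\<close>. The competitor's mean
      enters only through \<open>err_ge\<close> afterwards.\<close>
    have "0 \<le> (\<Sum>n=1..N. ?d / 2 * (ln (sig2 n / ?sig n) - 1 + ?sig n / sig2 n))"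
    proof (rule sum_nonneg)
      fix n assume n: "n \<in> {1..N}"
      then have pos: "0 < sig2 n" "0 < ?sig n" using mu star by auto
      then have "ln (?sig n / sig2 n) \<le> ?sig n / sig2 n - 1" by (intro ln_le_minus_one) simp
      then show "0 \<le> ?d / 2 * (ln (sig2 n / ?sig n) - 1 + ?sig n / sig2 n)"
        using pos by (intro mult_nonneg_nonneg) (simp_all add: ln_divide_pos)
    qed
    also have "\<dots> \<le> (\<Sum>n=1..N. (?d / 2 * ln (sig2 n / ?sig n) - ?d / 2) + (\<integral>z. err (mu n) n z / (2 * sig2 n) \<partial>?Q))"
    proof (rule sum_mono)
      fix n assume n: "n \<in> {1..N}"
      then have pos: "0 < sig2 n" and m: "mu n \<in> borel_measurable borel" using mu by auto
      have "integrable ?Q (err (mu n) n)" using integrable_mult_right[OF err_int[OF n], of "2 * sig2 n"] pos by simp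
      from err_ge[OF n m this] have "?d * ?sig n / (2 * sig2 n) \<le> (\<integral>z. err (mu n) n z / (2 * sig2 n) \<partial>?Q)"
        using pos by (simp add: divide_right_mono)
      then show "?d / 2 * (ln (sig2 n / ?sig n) - 1 + ?sig n / sig2 n) \<le> (?d / 2 * ln (sig2 n / ?sig n) - ?d / 2) + (\<integral>z. err (mu n) n z / (2 * sig2 n) \<partial>?Q)"
        by (simp add: algebra_simps)
    qed
    also have "\<dots> = (\<integral>z. ln (?R z) \<partial>?Q)"
      unfolding ln_R Bochner_Integration.integral_add[OF l_int sum_int] l_val sum.distrib
      using err_int by (subst Bochner_Integration.integral_sum) auto
    finally show "0 \<le> (\<integral>z. ln (?R z) \<partial>?Q)" .
  qed
  then show ?thesis unfolding rev_model_change[OF mu star, symmetric] .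
qed

end

theorem theorem1:
  fixes N :: nat and beta lam :: "nat \<Rightarrow> real" and q0 :: "'a::euclidean_space \<Rightarrow> real"
  assumes "N \<ge> 1"
    and "\<forall>n\<in>{1..N}. 0 < beta n \<and> beta n < 1"
    and "\<forall>n\<in>{1..N}. 0 \<le> lam n \<and> (lam n)\<^sup>2 \<le> bbar beta (n - 1)"
    and "q0 \<in> borel_measurable lborel"
    and "\<forall>x. 0 \<le> q0 x"
    and "(\<integral>\<^sup>+ x. ennreal (q0 x) \<partial>lborel) = 1"
    and "integrable lborel (\<lambda>x. q0 x * (norm x)\<^sup>2)"
  shows "(\<forall>n\<in>{1..N}. 0 < sigma2_star beta lam q0 n \<and> mu_star beta lam q0 n \<in> borel_measurable borel)
    \<and> (\<forall>(mu :: nat \<Rightarrow> 'a \<Rightarrow> 'a) (sig2 :: nat \<Rightarrow> real).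
         (\<forall>n\<in>{1..N}. mu n \<in> borel_measurable borel \<and> 0 < sig2 n) \<longrightarrow>
         KL (fwd_process N beta lam q0) (rev_model N (mu_star beta lam q0) (sigma2_star beta lam q0))
           \<le> KL (fwd_process N beta lam q0) (rev_model N mu sig2))"
proof -
  interpret diffusion N beta lam q0
    by unfold_locales (use assms in auto)
  show ?thesis
    using sigma2_star_pos borel_measurable_mu_star KL_star_le by blast
qed

end
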